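(* Let $m>1$ be an integer. For $i=1,\dots,m$ let $S_i:\mathbb{R}\to\mathbb{R}$, $S_i(x)=a_ix+b_i$, be contracting affine maps, i.e. $|a_i|<1$, and let $0<p_i<1$ be real numbers with $\sum_{i=1}^m p_i=1$. Let $\mu$ be the unique probability measure on $\mathbb{R}$ satisfying $\mu=\sum_{i=1}^m p_i\cdot \mu\circ S_i^{-1}$, and assume that the support $K$ of $\mu$ is not a single point. Let $$R(c;\mu)=\limsup_{t\to\infty}\frac{1}{t}\log\Big(\mathrm{Leb}\{\xi\in[-e^t,e^t]\;:\;|\mathcal{F}\mu(\xi)|\ge e^{-ct}\}\Big).$$ Then $$\lim_{c\to+0}R(c;\mu)=0.$$
   Context: $\mathrm{Leb}$ denotes Lebesgue measure on $\mathbb{R}$. The Fourier transform of $\mu$ is the real-analytic function $\mathcal{F}\mu(\xi)=\int \exp(-\sqrt{-1}\,\xi x)\,d\mu(x)$, $\xi\in\mathbb{R}$. The measure $\mu\circ S_i^{-1}$ is the push-forward of $\mu$ by $S_i$. The support $K$ of $\mu$ is the unique nonempty compact subset of $\mathbb{R}$ with $K=\bigcup_{i=1}^m S_i(K)$.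
   Formalization: The contraction ratios are additionally assumed to be nonzero (a_i ≠ 0); if some a_i = 0 then μ has an atom, and by Wiener's lemma R(c;μ) = 1 for all c > 0, so the claim fails. *)

theory Defs
  imports "HOL-Probability.Probability"
begin

text \<open>
  A Borel probability measure \<open>\<mu>\<close> with \<open>\<mu> = (\<Sum>i=1..m. p i \<cdot> (\<mu> \<circ> inverse (S i)))\<close>, where \<open>S i x = a i * x + b i\<close>.
  The library has no sum of measures, so the equation is stated on every Borel set.
  By Hutchinson's theorem there is exactly one such \<open>\<mu>\<close> when all \<open>\<bar>a i\<bar> < 1\<close> and \<open>p\<close> is a
  probability vector; statements about it quantify over all \<open>\<mu>\<close> satisfying this predicate.

  The maps \<open>S i\<close> are meant to be invertible, i.e. \<open>a i \<noteq> 0\<close>. If some \<open>a i = 0\<close>, then \<open>\<mu>\<close> has an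
  atom at \<open>b i\<close>, and Wiener's lemma gives \<open>large_freq_rate c \<mu> = 1\<close> for all \<open>c > 0\<close>.
\<close>

definition self_similar_measure ::
  "nat \<Rightarrow> (nat \<Rightarrow> real) \<Rightarrow> (nat \<Rightarrow> real) \<Rightarrow> (nat \<Rightarrow> real) \<Rightarrow> real measure \<Rightarrow> bool" where
  "self_similar_measure m a b p \<mu> \<longleftrightarrow>
     prob_space \<mu> \<and> sets \<mu> = sets borel \<and>
     (\<forall>A\<in>sets borel.
        measure \<mu> A = (\<Sum>i=1..m. p i * measure (distr \<mu> borel (\<lambda>x. a i * x + b i)) A))"

definition measure_support :: "'a::topological_space measure \<Rightarrow> 'a set" where
  "measure_support \<mu> = {x. \<forall>U. open U \<longrightarrow> x \<in> U \<longrightarrow> emeasure \<mu> U > 0}"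

text \<open>The sign convention is opposite to the library's \<^const>\<open>char\<close>.\<close>

definition fourier_transform :: "real measure \<Rightarrow> real \<Rightarrow> complex" where
  "fourier_transform \<mu> \<xi> = (CLINT x|\<mu>. exp (- \<i> * complex_of_real \<xi> * complex_of_real x))"

text \<open>
  For a probability measure \<open>\<mu>\<close> and \<open>c, t > 0\<close> the set below is closed, bounded and contains a
  neighbourhood of \<open>0\<close>, so its Lebesgue measure is finite and positive, and the conventions for
  \<open>ln 0\<close> and for \<open>measure\<close> of sets of infinite measure play no role.
\<close>

definition large_freq_rate :: "real \<Rightarrow> real measure \<Rightarrow> ereal" where
  "large_freq_rate c \<mu> =
     Limsup at_top (\<lambda>t::real. ereal (1 / t *
       ln (measure lborel {\<xi> \<in> {- exp t..exp t}. cmod (fourier_transform \<mu> \<xi>) \<ge> exp (- c * t)})))"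

end

theory Submission
  imports Defs
begin

text \<open>
  If not all \<open>S i\<close> share a fixed point, two of them, \<open>S i\<close> and \<open>S j\<close>, do not commute. Then in the
  second iterate of \<open>F \<xi> = (\<Sum>i. p i * cis (- b i * \<xi>) * F (a i * \<xi>))\<close> the terms of \<open>S i \<circ> S j\<close> and
  \<open>S j \<circ> S i\<close> carry the same ratio and combine to a factor \<open>\<bar>cos (\<beta> * \<xi>)\<bar>\<close>, which is bounded away
  from \<open>1\<close> unless \<open>\<xi>\<close> is close to a lattice.

  Let \<open>N s R\<close> be the supremum of the \<open>l\<^sup>q\<close> norm of \<open>\<bar>F\<bar>\<close> over \<open>s\<close>-separated subsets of \<open>[-R, R]\<close>.
  By Minkowski's inequality, \<open>N s R\<close> is bounded by the average over the words of the norms at the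
  contracted scales, whose ratios lie in \<open>[\<rho>, \<sigma>]\<close>. Words without damping (total weight \<open>\<theta> < 1\<close>) refine the separation to \<open>\<rho> * s\<close>;
  for the damped words only points near the lattice matter, and these are again separated by a fixed
  distance \<open>s0\<close>. Applying this \<open>n\<close> times, and splitting a \<open>\<rho> ^ n * s0\<close>-separated set into
  \<open>C \<approx> \<rho> powr (- n)\<close> many \<open>s0\<close>-separated ones at the end, gives \<open>N s0 R \<le> B * N s0 (\<sigma> * R)\<close> where
  \<open>B ^ q\<close> is close to \<open>C powr (\<theta> ^ n)\<close> for large \<open>q\<close>, hence close to \<open>1\<close> for large \<open>n\<close>. So
  \<open>N s0 R ^ q\<close> grows slower than any fixed power of \<open>R\<close>, and Markov's inequality bounds the
  superlevel sets of \<open>\<bar>F\<bar>\<close>.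
\<close>

section \<open>Separated sets\<close>

definition separated :: "real \<Rightarrow> real set \<Rightarrow> bool" where
  "separated s E \<longleftrightarrow> (\<forall>x\<in>E. \<forall>y\<in>E. x \<noteq> y \<longrightarrow> s \<le> \<bar>x - y\<bar>)"

lemma separatedD: "separated s E \<Longrightarrow> x \<in> E \<Longrightarrow> y \<in> E \<Longrightarrow> x \<noteq> y \<Longrightarrow> s \<le> \<bar>x - y\<bar>"
  by (auto simp: separated_def)

lemma separated_mono: "separated s E \<Longrightarrow> s' \<le> s \<Longrightarrow> F \<subseteq> E \<Longrightarrow> separated s' F"
  unfolding separated_def by (meson order_trans subsetD)

lemma separated_scale:
  assumes "separated s E" "r \<le> \<bar>a\<bar> * s"
  shows "separated r ((*) a ` E)"
proof -
  have "r \<le> \<bar>a * x - a * y\<bar>" if "x \<in> E" "y \<in> E" "a * x \<noteq> a * y" for x y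
  proof -
    have "s \<le> \<bar>x - y\<bar>" using separatedD[OF assms(1)] that by auto
    then have "\<bar>a\<bar> * s \<le> \<bar>a\<bar> * \<bar>x - y\<bar>" by (simp add: mult_left_mono)
    also have "\<dots> = \<bar>a * x - a * y\<bar>" by (simp add: abs_mult[symmetric] right_diff_distrib)
    finally show ?thesis using assms(2) by linarith
  qed
  then show ?thesis unfolding separated_def by blast
qed

lemma inj_on_floor_separated:
  assumes "separated s E" "0 < s"
  shows "inj_on (\<lambda>x. \<lfloor>x / s\<rfloor>) E"
proof (rule inj_onI, rule ccontr)
  fix x y assume xy: "x \<in> E" "y \<in> E" "\<lfloor>x / s\<rfloor> = \<lfloor>y / s\<rfloor>" "x \<noteq> y"
  then have "s \<le> \<bar>x - y\<bar>" using separatedD[OF assms(1)] by auto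
  moreover have "\<bar>x / s - y / s\<bar> < 1" using xy(3) by linarith
  then have "\<bar>x - y\<bar> < s" using \<open>0 < s\<close> by (simp add: diff_divide_distrib[symmetric] field_simps)
  ultimately show False by simp
qed

text \<open>Each cell \<open>\<lfloor>x / s\<rfloor>\<close> holds at most one point of
  \<open>E\<close>, and the window meets finitely many cells. What matters is that \<open>N\<close>
  does not depend on \<open>E\<close>.\<close>

lemma separated_card_bound:
  assumes "0 < s"
  shows "\<exists>N. \<forall>E. E \<subseteq> {-R..R} \<and> separated s E \<longrightarrow> finite E \<and> card E \<le> N"
proof (intro exI allI impI)
  fix E assume E: "E \<subseteq> {-R..R} \<and> separated s E"
  let ?g = "\<lambda>x. \<lfloor>x / s\<rfloor>" and ?A = "{\<lfloor>-R / s\<rfloor>..\<lfloor>R / s\<rfloor>}"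
  have "?g x \<in> ?A" if "x \<in> E" for x
  proof -
    have "-R \<le> x" "x \<le> R" using E that by auto
    then have "-R / s \<le> x / s" "x / s \<le> R / s"
      using assms by (auto intro: divide_right_mono simp only: less_imp_le)
    then show ?thesis by (simp add: floor_mono)
  qed
  then have "?g ` E \<subseteq> ?A" by blast
  then show "finite E \<and> card E \<le> card ?A"
    using inj_on_floor_separated[of s E] E assms
    by (metis card_inj_on_le finite_atLeastAtMost_int inj_on_finite)
qed

text \<open>For nonnegative \<open>f\<close>, \<open>X\<close> and positive \<open>p\<close>, this
  says that the supremum \<open>N s R\<close> of the l^p norms is at most \<open>X\<close>. The
  relational form avoids both the supremum and the p-th root.\<close>

definition sep_bound :: "(real \<Rightarrow> real) \<Rightarrow> nat \<Rightarrow> real \<Rightarrow> real \<Rightarrow> real \<Rightarrow> bool" where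
  "sep_bound f p s R X \<longleftrightarrow>
     (\<forall>E. finite E \<and> E \<subseteq> {-R..R} \<and> separated s E \<longrightarrow> (\<Sum>\<xi>\<in>E. f \<xi> ^ p) \<le> X ^ p)"

lemma sep_boundD:
  "sep_bound f p s R X \<Longrightarrow> finite E \<Longrightarrow> E \<subseteq> {-R..R} \<Longrightarrow> separated s E \<Longrightarrow> (\<Sum>\<xi>\<in>E. f \<xi> ^ p) \<le> X ^ p"
  by (auto simp: sep_bound_def)

lemma sep_bound_mono:
  assumes "sep_bound f p s R X" "s \<le> s'" "R' \<le> R"
  shows "sep_bound f p s' R' X"
  unfolding sep_bound_def
proof (intro allI impI)
  fix E assume E: "finite E \<and> E \<subseteq> {-R'..R'} \<and> separated s' E"
  then have "E \<subseteq> {-R..R}" using assms(3) by force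
  then show "(\<Sum>\<xi>\<in>E. f \<xi> ^ p) \<le> X ^ p"
    using E separated_mono[of s' E s E] assms by (intro sep_boundD[OF assms(1)]) auto
qed

text \<open>Substituting \<open>a * \<xi>\<close> turns a sum at a contracted frequency into a sum
  over the image of \<open>E\<close>, which lies in a smaller window but may be more finely
  spaced.\<close>

lemma sep_bound_scaled:
  assumes "sep_bound f p r (\<sigma> * R) X" "finite E" "E \<subseteq> {-R..R}" "separated s E"
    and "a \<noteq> 0" "r \<le> \<bar>a\<bar> * s" "\<bar>a\<bar> \<le> \<sigma>"
  shows "(\<Sum>\<xi>\<in>E. f (a * \<xi>) ^ p) \<le> X ^ p"
proof -
  have "(\<Sum>\<xi>\<in>E. f (a * \<xi>) ^ p) = (\<Sum>\<xi>\<in>(*) a ` E. f \<xi> ^ p)"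
    using \<open>a \<noteq> 0\<close> by (subst sum.reindex) (auto simp: inj_on_def)
  also have "\<dots> \<le> X ^ p"
  proof (rule sep_boundD[OF assms(1)])
    show "(*) a ` E \<subseteq> {- (\<sigma> * R)..\<sigma> * R}"
    proof safe
      fix x assume "x \<in> E"
      then have "\<bar>x\<bar> \<le> R" using assms(3) by force
      then have "\<bar>a * x\<bar> \<le> \<sigma> * R"
        using assms(7) by (auto simp: abs_mult intro!: mult_mono)
      then show "a * x \<in> {- (\<sigma> * R)..\<sigma> * R}" by auto
    qed
  qed (use assms separated_scale in auto)
  finally show ?thesis .
qed

text \<open>
  Points of a finely separated set whose cells \<open>\<lfloor>x / s\<rfloor>\<close> agree modulo \<open>C\<close> are coarsely separated.
\<close>

lemma sep_bound_refine:
  fixes C :: nat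
  assumes bd: "sep_bound f p s0 R X" and s: "0 < s" "s0 / s + 1 \<le> C"
    and c: "real C \<le> c ^ p" and X: "0 \<le> X" and C: "0 < C"
  shows "sep_bound f p s R (c * X)"
  unfolding sep_bound_def
proof (intro allI impI)
  fix E assume E: "finite E \<and> E \<subseteq> {-R..R} \<and> separated s E"
  define g where "g = (\<lambda>x::real. nat (\<lfloor>x / s\<rfloor> mod int C))"
  have "(\<Sum>\<xi>\<in>E. f \<xi> ^ p) = (\<Sum>r<C. \<Sum>\<xi>\<in>{\<xi>\<in>E. g \<xi> = r}. f \<xi> ^ p)"
    using E C by (intro sum.group[symmetric]) (auto simp: g_def nat_less_iff)
  also have "\<dots> \<le> (\<Sum>r<C. X ^ p)"
  proof (rule sum_mono)
    fix r
    have "separated s0 {\<xi>\<in>E. g \<xi> = r}"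
      unfolding separated_def
    proof safe
      fix x y assume xy: "x \<in> E" "y \<in> E" "x \<noteq> y" "r = g x" "g y = g x"
      let ?i = "\<lfloor>x / s\<rfloor>" and ?j = "\<lfloor>y / s\<rfloor>"
      have ne: "?i \<noteq> ?j"
        using inj_on_floor_separated[of s E] E s(1) xy by (auto simp: inj_on_def)
      have "?i mod int C = ?j mod int C"
        using xy(5) C unfolding g_def by (simp add: nat_eq_iff)
      then have "int C dvd ?i - ?j" by (simp add: mod_eq_dvd_iff)
      then have "int C \<le> \<bar>?i - ?j\<bar>"
        using ne by (intro zdvd_imp_le) (auto)
      \<comment> \<open>Floors that differ by \<open>C\<close> only force the quotients to differ by
        more than \<open>C - 1\<close>. This loss accounts for the \<open>+ 1\<close> in
        \<open>s0 / s + 1 \<le> C\<close>.\<close>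
      then have "real C - 1 \<le> \<bar>x / s - y / s\<bar>" by linarith
      then have "s0 / s \<le> \<bar>x - y\<bar> / s"
        using s by (simp add: diff_divide_distrib[symmetric])
      then show "s0 \<le> \<bar>x - y\<bar>" using s(1) by (simp add: divide_le_cancel)
    qed
    then show "(\<Sum>\<xi>\<in>{\<xi>\<in>E. g \<xi> = r}. f \<xi> ^ p) \<le> X ^ p"
      using E by (intro sep_boundD[OF bd]) auto
  qed
  also have "\<dots> = real C * X ^ p" by simp
  also have "\<dots> \<le> (c * X) ^ p"
    using c X by (simp add: power_mult_distrib mult_right_mono)
  finally show "(\<Sum>\<xi>\<in>E. f \<xi> ^ p) \<le> (c * X) ^ p" .
qed

section \<open>Convexity of powers and Minkowski's inequality\<close>

lemma convex_on_power_nonneg: "convex_on {0::real..} (\<lambda>x. x ^ n)"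
proof (cases "even n")
  case True
  show ?thesis
    by (rule convex_on_subset[OF convex_power_even[OF True]]) auto
qed (rule convex_power_odd)

text \<open>Normalise each \<open>y i\<close> by its norm bound \<open>N i\<close> and move these
  bounds into the weights \<open>l i = c i * N i / S\<close>, which again sum to 1. Jensen's
  inequality for the p-th power at each point, summed over \<open>E\<close>, then gives the
  claim.\<close>

lemma minkowski_finite_sum:
  fixes y :: "'i \<Rightarrow> 'x \<Rightarrow> real"
  assumes I: "finite I" "(\<Sum>i\<in>I. c i) = 1" "\<And>i. i \<in> I \<Longrightarrow> 0 \<le> c i"
    and y: "\<And>i x. i \<in> I \<Longrightarrow> x \<in> E \<Longrightarrow> 0 \<le> y i x"
    and N: "\<And>i. i \<in> I \<Longrightarrow> 0 < N i" "\<And>i. i \<in> I \<Longrightarrow> (\<Sum>x\<in>E. y i x ^ p) \<le> N i ^ p"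
  shows "(\<Sum>x\<in>E. (\<Sum>i\<in>I. c i * y i x) ^ p) \<le> (\<Sum>i\<in>I. c i * N i) ^ p"
proof -
  define S where "S = (\<Sum>i\<in>I. c i * N i)"
  have ne: "I \<noteq> {}" using I(2) by auto
  obtain j where j: "j \<in> I" "0 < c j"
    using I by (metis less_eq_real_def sum.neutral zero_neq_one)
  have S: "0 < S" unfolding S_def
    using j I(1,3) N(1) by (intro sum_pos2[where i=j]) (auto intro!: mult_nonneg_nonneg less_imp_le[of 0 "N _"])
  define l where "l i = c i * N i / S" for i
  have l: "(\<Sum>i\<in>I. l i) = 1" "\<And>i. i \<in> I \<Longrightarrow> 0 \<le> l i"
    unfolding l_def using S I(3) N(1)
    by (auto simp: sum_divide_distrib[symmetric] S_def[symmetric] intro!: divide_nonneg_pos mult_nonneg_nonneg less_imp_le[of 0 "N _"])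
  have "(\<Sum>i\<in>I. c i * y i x) ^ p \<le> S ^ p * (\<Sum>i\<in>I. l i * (y i x / N i) ^ p)" if "x \<in> E" for x
  proof -
    have "(\<Sum>i\<in>I. c i * y i x) = S * (\<Sum>i\<in>I. l i *\<^sub>R (y i x / N i))"
      unfolding sum_distrib_left
    proof (rule sum.cong[OF refl])
      fix i assume "i \<in> I"
      then show "c i * y i x = S * l i *\<^sub>R (y i x / N i)"
        using S N(1)[of i] by (simp add: l_def)
    qed
    moreover have "(\<Sum>i\<in>I. l i *\<^sub>R (y i x / N i)) ^ p \<le> (\<Sum>i\<in>I. l i * (y i x / N i) ^ p)"
      by (rule convex_on_sum[OF I(1) ne convex_on_power_nonneg l])
        (use y N(1) that in \<open>auto intro!: divide_nonneg_pos\<close>)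
    ultimately show ?thesis using S by (simp add: power_mult_distrib)
  qed
  then have "(\<Sum>x\<in>E. (\<Sum>i\<in>I. c i * y i x) ^ p) \<le> (\<Sum>x\<in>E. S ^ p * (\<Sum>i\<in>I. l i * (y i x / N i) ^ p))"
    by (rule sum_mono)
  also have "\<dots> = S ^ p * (\<Sum>i\<in>I. l i * ((\<Sum>x\<in>E. y i x ^ p) / N i ^ p))"
    by (subst sum_distrib_left[symmetric], subst sum.swap)
      (simp add: sum_distrib_left power_divide sum_divide_distrib)
  also have "\<dots> \<le> S ^ p * (\<Sum>i\<in>I. l i * 1)"
  proof (intro mult_left_mono sum_mono)
    fix i assume "i \<in> I"
    then show "(\<Sum>x\<in>E. y i x ^ p) / N i ^ p \<le> 1" "0 \<le> l i"
      using N[of i] l by auto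
  qed (use S in auto)
  finally show ?thesis using l S by (simp add: S_def)
qed

section \<open>Power sums under a damped recursion\<close>

text \<open>In the application \<open>f\<close> is the modulus of the Fourier transform,
  \<open>K\<close> the set of words of length two with weights \<open>q\<close> and ratios
  \<open>\<alpha>\<close>, and \<open>G\<close> the two interfering words, damped by a cosine factor
  \<open>w\<close>. Condition \<open>near\<close> says that the damping is weak only close to the
  lattice of spacing \<open>L\<close>.\<close>

locale damped_recursion =
  fixes f w :: "real \<Rightarrow> real" and K G :: "'k set" and q \<alpha> :: "'k \<Rightarrow> real" and \<rho> \<sigma> L :: real
  assumes finite_K: "finite K" and G: "G \<subseteq> K" "G \<noteq> {}"
    and q_pos: "\<And>k. k \<in> K \<Longrightarrow> 0 < q k" and q_sum: "(\<Sum>k\<in>K. q k) = 1"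
    and \<rho>_pos: "0 < \<rho>" and \<sigma>_less: "\<sigma> < 1"
    and \<alpha>: "\<And>k. k \<in> K \<Longrightarrow> \<rho> \<le> \<bar>\<alpha> k\<bar> \<and> \<bar>\<alpha> k\<bar> \<le> \<sigma>"
    and f: "\<And>\<xi>. 0 \<le> f \<xi> \<and> f \<xi> \<le> 1" and w: "\<And>\<xi>. 0 \<le> w \<xi> \<and> w \<xi> \<le> 1"
    and L: "0 < L"
    and near: "\<And>\<eta>. 0 < \<eta> \<Longrightarrow>
      \<exists>\<kappa>. 0 \<le> \<kappa> \<and> \<kappa> < 1 \<and> (\<forall>\<xi>. \<kappa> < w \<xi> \<longrightarrow> (\<exists>N::int. \<bar>\<xi> - N * L\<bar> \<le> \<eta>))"
    and recursion: "\<And>\<xi>. f \<xi> \<le> (\<Sum>k\<in>K. q k * ((if k \<in> G then w \<xi> else 1) * f (\<alpha> k * \<xi>)))"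
begin

definition "\<theta> = (\<Sum>k\<in>K - G. q k)"
text \<open>Weakly damped frequencies turn out to be \<open>L / 2\<close>-separated, and
  multiplication by any \<open>\<alpha> k\<close> shrinks gaps by at most the factor
  \<open>\<rho>\<close>.\<close>

definition "s0 = \<rho> * L / 2"

lemma sum_G: "(\<Sum>k\<in>G. q k) = 1 - \<theta>"
  using q_sum sum.subset_diff[OF G(1) finite_K, of q] by (simp add: \<theta>_def)

lemma \<theta>: "0 \<le> \<theta>" "\<theta> < 1"
proof -
  show "0 \<le> \<theta>" unfolding \<theta>_def using q_pos by (intro sum_nonneg) (auto intro: less_imp_le)
  have "0 < (\<Sum>k\<in>G. q k)" using G finite_K q_pos by (intro sum_pos) (auto dest: finite_subset)
  then show "\<theta> < 1" using sum_G by simp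
qed

lemma s0_pos: "0 < s0" using \<rho>_pos L by (simp add: s0_def)

lemma \<rho>_le_\<sigma>: "\<rho> \<le> \<sigma>" using G \<alpha> by fastforce

lemma \<sigma>_pos: "0 < \<sigma>" using \<rho>_le_\<sigma> \<rho>_pos by simp

text \<open>
  A frequency with \<open>w \<xi>\<close> near \<open>1\<close> is determined up to \<open>\<eta>\<close> by an integer, so among the points of
  a finely separated set such frequencies are again coarsely separated. This is the counting step
  of Erdos and Kahane; it makes the number of relevant points independent of the fine scale \<open>s\<close>.
\<close>

lemma sep_bound_step:
  assumes \<eta>: "2 * \<eta> < s" "\<eta> \<le> L / 4"
    and \<kappa>: "0 \<le> \<kappa>" "\<And>\<xi>. \<kappa> < w \<xi> \<Longrightarrow> \<exists>N::int. \<bar>\<xi> - N * L\<bar> \<le> \<eta>"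
    and X: "sep_bound f p s0 (\<sigma> * R) X" "0 < X"
    and Y: "sep_bound f p (\<rho> * s) (\<sigma> * R) Y" "0 < Y"
    and Z: "sep_bound f p (\<rho> * s) (\<sigma> * R) Z"
    and d: "0 < d" "X ^ p + (\<kappa> * Z) ^ p \<le> (d * X) ^ p" and s: "0 \<le> s"
  shows "sep_bound f p s R ((1 - \<theta>) * (d * X) + \<theta> * Y)"
  unfolding sep_bound_def
proof (intro allI impI)
  fix E assume "finite E \<and> E \<subseteq> {-R..R} \<and> separated s E"
  then have E: "finite E" "E \<subseteq> {-R..R}" "separated s E" by auto
  define y where "y k \<xi> = (if k \<in> G then w \<xi> else 1) * f (\<alpha> k * \<xi>)" for k \<xi>
  \<comment> \<open>\<open>N k\<close> bounds the l^p norm of the k-th term. Undamped words use the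
    fine-scale bound \<open>Y\<close>. Damped words use the coarse bound \<open>X\<close> near the
    lattice and the fine bound \<open>Z\<close> with factor \<open>\<kappa>\<close> elsewhere;
    \<open>d\<close> absorbs the second contribution.\<close>
  define N where "N k = (if k \<in> G then d * X else Y)" for k
  have rs: "\<rho> * s \<le> \<bar>\<alpha> k\<bar> * s" "\<alpha> k \<noteq> 0" "\<bar>\<alpha> k\<bar> \<le> \<sigma>" if "k \<in> K" for k
    using \<alpha>[OF that] \<rho>_pos s by (auto intro: mult_right_mono)
  have "(\<Sum>\<xi>\<in>E. y k \<xi> ^ p) \<le> N k ^ p" if "k \<in> K" for k
  proof (cases "k \<in> G")
    case False
    then show ?thesis
      using sep_bound_scaled[OF Y(1) E, of "\<alpha> k"] rs[OF that] by (simp add: y_def N_def)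
  next
    case True
    define A where "A = {\<xi>\<in>E. \<kappa> < w \<xi>}"
    have A: "finite A" "A \<subseteq> {-R..R}" using E by (auto simp: A_def)
    \<comment> \<open>Points of \<open>A\<close> are more than \<open>2 * \<eta>\<close> apart, so
      they belong to different lattice points and their distance is at least
      \<open>L - 2 * \<eta>\<close>.\<close>
    have "separated (L / 2) A"
      unfolding separated_def
    proof (intro ballI impI)
      fix x x' assume xx: "x \<in> A" "x' \<in> A" "x \<noteq> x'"
      obtain M M' :: int where M: "\<bar>x - M * L\<bar> \<le> \<eta>" "\<bar>x' - M' * L\<bar> \<le> \<eta>"
        using \<kappa>(2) xx by (auto simp: A_def) blast
      have "s \<le> \<bar>x - x'\<bar>" using separatedD[OF E(3)] xx by (auto simp: A_def)
      then have "M \<noteq> M'" using M \<eta>(1) by auto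
      then have "1 \<le> \<bar>real_of_int M - real_of_int M'\<bar>" by linarith
      then have "L \<le> \<bar>real_of_int M - real_of_int M'\<bar> * L" using L by simp
      also have "\<dots> = \<bar>M * L - M' * L\<bar>"
        using L by (simp add: abs_mult left_diff_distrib[symmetric])
      finally show "L / 2 \<le> \<bar>x - x'\<bar>" using M \<eta>(2) by linarith
    qed
    moreover have "s0 \<le> \<bar>\<alpha> k\<bar> * (L / 2)"
      using \<alpha>[OF that] L by (simp add: s0_def)
    ultimately have "(\<Sum>\<xi>\<in>A. f (\<alpha> k * \<xi>) ^ p) \<le> X ^ p"
      using sep_bound_scaled[OF X(1) A] rs(2,3)[OF that] by simp
    then have 1: "(\<Sum>\<xi>\<in>A. y k \<xi> ^ p) \<le> X ^ p"
      by (rule order_trans[rotated])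
        (use f w True in \<open>auto intro!: sum_mono power_mono mult_left_le_one_le simp: y_def\<close>)
    have "(\<Sum>\<xi>\<in>E - A. y k \<xi> ^ p) \<le> (\<Sum>\<xi>\<in>E - A. (\<kappa> * f (\<alpha> k * \<xi>)) ^ p)"
      using f w True by (auto intro!: sum_mono power_mono mult_right_mono mult_nonneg_nonneg simp: y_def A_def)
    also have "\<dots> \<le> (\<Sum>\<xi>\<in>E. (\<kappa> * f (\<alpha> k * \<xi>)) ^ p)"
      using f \<kappa>(1) E(1) by (intro sum_mono2) auto
    also have "\<dots> = \<kappa> ^ p * (\<Sum>\<xi>\<in>E. f (\<alpha> k * \<xi>) ^ p)"
      by (simp add: power_mult_distrib sum_distrib_left)
    also have "\<dots> \<le> \<kappa> ^ p * Z ^ p"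
      using sep_bound_scaled[OF Z E, of "\<alpha> k"] rs[OF that] \<kappa>(1) by (intro mult_left_mono) auto
    finally have 2: "(\<Sum>\<xi>\<in>E - A. y k \<xi> ^ p) \<le> (\<kappa> * Z) ^ p" by (simp add: power_mult_distrib)
    have "(\<Sum>\<xi>\<in>E. y k \<xi> ^ p) = (\<Sum>\<xi>\<in>E - A. y k \<xi> ^ p) + (\<Sum>\<xi>\<in>A. y k \<xi> ^ p)"
      using E(1) by (intro sum.subset_diff) (auto simp: A_def)
    then show ?thesis using 1 2 d(2) True by (simp add: N_def)
  qed
  then have mink: "(\<Sum>\<xi>\<in>E. (\<Sum>k\<in>K. q k * y k \<xi>) ^ p) \<le> (\<Sum>k\<in>K. q k * N k) ^ p"
    using finite_K q_sum q_pos f w d(1) X(2) Y(2)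
    by (intro minkowski_finite_sum) (auto simp: y_def N_def intro: less_imp_le)
  have "(\<Sum>\<xi>\<in>E. f \<xi> ^ p) \<le> (\<Sum>\<xi>\<in>E. (\<Sum>k\<in>K. q k * y k \<xi>) ^ p)"
    using recursion f by (auto intro!: sum_mono power_mono simp: y_def)
  also note mink
  also have "(\<Sum>k\<in>K. q k * N k) = (\<Sum>k\<in>K - G. q k * Y) + (\<Sum>k\<in>G. q k * (d * X))"
    unfolding sum.subset_diff[OF G(1) finite_K] by (simp add: N_def)
  also have "\<dots> = (1 - \<theta>) * (d * X) + \<theta> * Y"
    by (simp only: sum_distrib_right[symmetric] sum_G \<theta>_def[symmetric])
  finally show "(\<Sum>\<xi>\<in>E. f \<xi> ^ p) \<le> ((1 - \<theta>) * (d * X) + \<theta> * Y) ^ p" .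
qed

text \<open>Start at the finest spacing \<open>\<rho> ^ n * s0\<close> with the bound
  \<open>c * X\<close> and coarsen one power of \<open>\<rho>\<close> at a time. Each step applies
  the affine map with fixed point \<open>d * X\<close> and slope \<open>\<theta>\<close>, so after
  \<open>n\<close> steps the excess over \<open>d\<close> has shrunk to
  \<open>\<theta> ^ n * (c - d)\<close>.\<close>

lemma sep_bound_growth:
  fixes C :: nat
  assumes n: "0 < n" and \<eta>: "2 * \<eta> < \<rho> ^ n * s0" "\<eta> \<le> L / 4"
    and \<kappa>: "0 \<le> \<kappa>" "\<And>\<xi>. \<kappa> < w \<xi> \<Longrightarrow> \<exists>N::int. \<bar>\<xi> - N * L\<bar> \<le> \<eta>"
    and C: "1 / \<rho> ^ n + 1 \<le> real C" "real C \<le> c ^ p" and c: "0 < c"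
    and d: "0 < d" "1 + (\<kappa> * c) ^ p \<le> d ^ p"
    and X: "sep_bound f p s0 (\<sigma> * R) X" "0 < X" and R: "0 \<le> R"
  shows "sep_bound f p s0 R ((d + \<theta> ^ n * (c - d)) * X)"
proof -
  have "0 < 1 / \<rho> ^ n" using \<rho>_pos by simp
  then have "0 < real C" using C(1) by linarith
  then have C0: "0 < C" by simp
  have fine: "sep_bound f p (\<rho> ^ n * s0) (\<sigma> * R) (c * X)"
    by (rule sep_bound_refine[OF X(1) _ _ C(2)]) (use C C0 \<rho>_pos s0_pos X(2) in auto)
  have \<rho>1: "\<rho> \<le> 1" using \<rho>_le_\<sigma> \<sigma>_less by simp
  have pow: "\<rho> ^ n * s0 \<le> \<rho> ^ j * s0" if "j \<le> n" for j
    using that \<rho>_pos \<rho>1 s0_pos by (intro mult_right_mono power_decreasing) auto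
  have dX: "X ^ p + (\<kappa> * (c * X)) ^ p \<le> (d * X) ^ p"
  proof -
    have "X ^ p + (\<kappa> * (c * X)) ^ p = (1 + (\<kappa> * c) ^ p) * X ^ p"
      by (simp add: power_mult_distrib algebra_simps)
    also have "\<dots> \<le> d ^ p * X ^ p" using d(2) X(2) by (intro mult_right_mono) auto
    finally show ?thesis by (simp add: power_mult_distrib)
  qed
  have pos: "0 < d + \<theta> ^ i * (c - d)" for i
  proof -
    have "\<theta> ^ i \<le> 1" using \<theta> by (simp add: power_le_one)
    moreover have "0 \<le> \<theta> ^ i" using \<theta> by simp
    ultimately have "0 < (1 - \<theta> ^ i) * d + \<theta> ^ i * c"
      using d(1) c by (cases "\<theta> ^ i = 1") (auto intro: add_pos_nonneg)
    then show ?thesis by (simp add: algebra_simps)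
  qed
  have step: "sep_bound f p (\<rho> ^ j * s0) R' ((d + \<theta> ^ Suc i * (c - d)) * X)"
    if j: "Suc j \<le> n" and R': "R' \<le> R" and 1: "sep_bound f p (\<rho> ^ Suc j * s0) (\<sigma> * R) ((d + \<theta> ^ i * (c - d)) * X)"
    for i j R'
  proof -
    have R'': "\<sigma> * R' \<le> \<sigma> * R" using R' \<sigma>_pos by simp
    have "sep_bound f p (\<rho> ^ j * s0) R' ((1 - \<theta>) * (d * X) + \<theta> * ((d + \<theta> ^ i * (c - d)) * X))"
    proof (rule sep_bound_step[OF _ \<eta>(2) \<kappa> _ X(2) _ _ _ d(1) dX])
      show "2 * \<eta> < \<rho> ^ j * s0" using \<eta>(1) pow[of j] j by simp
      show "sep_bound f p s0 (\<sigma> * R') X" by (rule sep_bound_mono[OF X(1) _ R'']) simp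
      show "sep_bound f p (\<rho> * (\<rho> ^ j * s0)) (\<sigma> * R') ((d + \<theta> ^ i * (c - d)) * X)"
        using sep_bound_mono[OF 1 _ R''] by (simp add: mult.assoc)
      show "sep_bound f p (\<rho> * (\<rho> ^ j * s0)) (\<sigma> * R') (c * X)"
        using sep_bound_mono[OF fine pow[OF j] R''] by (simp add: mult.assoc)
      show "0 < (d + \<theta> ^ i * (c - d)) * X" using pos X(2) by simp
      show "0 \<le> \<rho> ^ j * s0" using \<rho>_pos s0_pos by simp
    qed
    also have "(1 - \<theta>) * (d * X) + \<theta> * ((d + \<theta> ^ i * (c - d)) * X) = (d + \<theta> ^ Suc i * (c - d)) * X"
      by (simp add: algebra_simps)
    finally show ?thesis .
  qed
  \<comment> \<open>These levels all stay in the window \<open>\<sigma> * R\<close>, where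
    \<open>X\<close> is available. Only the last step, from level \<open>n - 1\<close>, passes to
    the full window \<open>R\<close>.\<close>
  have lev: "sep_bound f p (\<rho> ^ (n - i) * s0) (\<sigma> * R) ((d + \<theta> ^ i * (c - d)) * X)" if "i \<le> n" for i
    using that
  proof (induction i)
    case 0
    then show ?case using fine by simp
  next
    case (Suc i)
    have "\<sigma> * R \<le> R" using R \<sigma>_less by (simp add: mult_left_le_one_le \<sigma>_pos less_imp_le)
    moreover have "Suc (n - Suc i) = n - i" using Suc.prems by simp
    ultimately show ?case using step[of "n - Suc i" "\<sigma> * R" i] Suc by simp
  qed
  show ?thesis using step[of 0 R "n - 1"] lev[of "n - 1"] n by simp
qed

text \<open>The order of the choices is decisive: \<open>n\<close> comes first, then
  \<open>C\<close>, \<open>\<eta>\<close> and \<open>\<kappa>\<close>, and only then the exponent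
  \<open>p\<close>. Refining costs a factor \<open>C\<close> in the power sum, but only the portion
  \<open>\<theta> ^ n\<close> of its logarithm survives, and a large \<open>p\<close> makes the
  damped part negligible.\<close>

lemma sep_bound_growth_rate:
  assumes "0 < \<delta>"
  shows "\<exists>p B. 0 < p \<and> 0 < B \<and> B ^ p \<le> exp \<delta> \<and>
    (\<forall>R\<ge>0. \<forall>X>0. sep_bound f p s0 (\<sigma> * R) X \<longrightarrow> sep_bound f p s0 R (B * X))"
proof -
  \<comment> \<open>Since \<open>ln C\<close> is at most \<open>ln 3 + n * ln (1 / \<rho>)\<close>,
    it grows only linearly in \<open>n\<close>, and the geometric decay of
    \<open>\<theta> ^ n\<close> wins.\<close>
  have "(\<lambda>n. 2 * (ln 3 * \<theta> ^ n + ln (1 / \<rho>) * (real n * \<theta> ^ n))) \<longlonglongrightarrow> 2 * (ln 3 * 0 + ln (1 / \<rho>) * 0)"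
    using \<theta> by (intro tendsto_intros LIMSEQ_power_zero powser_times_n_limit_0) auto
  then have "\<forall>\<^sub>F n in sequentially. 2 * (ln 3 * \<theta> ^ n + ln (1 / \<rho>) * (real n * \<theta> ^ n)) < \<delta> / 2"
    by (rule order_tendstoD(2)) (use assms in simp)
  then obtain n where n: "0 < n" "2 * (ln 3 * \<theta> ^ n + ln (1 / \<rho>) * (real n * \<theta> ^ n)) < \<delta> / 2"
    using eventually_happens[OF eventually_conj[OF eventually_gt_at_top[of "0::nat"]]] trivial_limit_sequentially
    by blast
  define C where "C = nat \<lceil>1 / \<rho> ^ n\<rceil> + 1"
  have \<rho>1: "\<rho> \<le> 1" using \<rho>_le_\<sigma> \<sigma>_less by simp
  have inv1: "1 \<le> 1 / \<rho> ^ n" using \<rho>_pos \<rho>1 by (simp add: power_le_one)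
  have C: "1 / \<rho> ^ n + 1 \<le> real C" "real C \<le> 3 / \<rho> ^ n" "1 \<le> real C"
  proof -
    have "0 \<le> \<lceil>1 / \<rho> ^ n\<rceil>" using inv1 by linarith
    then have "real C = of_int \<lceil>1 / \<rho> ^ n\<rceil> + 1" by (simp add: C_def)
    then show "1 / \<rho> ^ n + 1 \<le> real C" "real C \<le> 3 / \<rho> ^ n" "1 \<le> real C"
      using inv1 by (linarith, simp, linarith, linarith)
  qed
  define l where "l = ln (real C)"
  have l: "0 \<le> l" "exp l = real C" using C by (auto simp: l_def)
  have "l \<le> ln (3 / \<rho> ^ n)" unfolding l_def using C(2,3) by (intro ln_mono) auto
  also have "\<dots> = ln 3 + n * ln (1 / \<rho>)"
    using \<rho>_pos by (simp add: ln_div ln_realpow)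
  finally have "2 * (\<theta> ^ n * l) \<le> 2 * (\<theta> ^ n * (ln 3 + n * ln (1 / \<rho>)))"
    using \<theta> by (intro mult_left_mono) auto
  then have \<theta>l: "2 * (\<theta> ^ n * l) < \<delta> / 2" using n(2) by (simp add: algebra_simps)
  define \<eta> where "\<eta> = min (L / 4) (\<rho> ^ n * s0 / 3)"
  have \<eta>: "0 < \<eta>" "2 * \<eta> < \<rho> ^ n * s0" "\<eta> \<le> L / 4"
  proof -
    have "0 < \<rho> ^ n * s0" using \<rho>_pos s0_pos by simp
    then show "0 < \<eta>" "2 * \<eta> < \<rho> ^ n * s0" "\<eta> \<le> L / 4" using L by (auto simp: \<eta>_def min_def mult.commute)
  qed
  obtain \<kappa> where \<kappa>: "0 \<le> \<kappa>" "\<kappa> < 1" "\<And>\<xi>. \<kappa> < w \<xi> \<Longrightarrow> \<exists>N::int. \<bar>\<xi> - N * L\<bar> \<le> \<eta>"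
    using near[OF \<eta>(1)] by blast
  \<comment> \<open>The factor \<open>exp (2 * l)\<close> will bound \<open>c ^ p\<close>, so this
    makes \<open>(\<kappa> * c) ^ p\<close> small.\<close>
  have "(\<lambda>p. \<kappa> ^ p * exp (2 * l)) \<longlonglongrightarrow> 0 * exp (2 * l)"
    using \<kappa> by (intro tendsto_intros LIMSEQ_power_zero) auto
  then have "\<forall>\<^sub>F p in sequentially. \<kappa> ^ p * exp (2 * l) < \<delta> / 2"
    by (rule order_tendstoD(2)) (use assms in simp)
  moreover have "\<forall>\<^sub>F p in sequentially. l \<le> real p"
    using filterlim_real_sequentially by (simp add: filterlim_at_top)
  moreover have "\<forall>\<^sub>F p::nat in sequentially. 0 < p" by (rule eventually_gt_at_top)
  ultimately have "\<forall>\<^sub>F p in sequentially. \<kappa> ^ p * exp (2 * l) < \<delta> / 2 \<and> l \<le> real p \<and> 0 < p"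
    by eventually_elim auto
  then obtain p where p: "\<kappa> ^ p * exp (2 * l) < \<delta> / 2" "l \<le> real p" "0 < p"
    using eventually_happens[of _ sequentially] trivial_limit_sequentially by blast
  \<comment> \<open>A convenient upper bound for the p-th root of \<open>C\<close>: for
    \<open>l \<le> p\<close> one has \<open>exp (l / p) \<le> 1 + 2 * l / p\<close>, while
    \<open>c ^ p\<close> stays below the square of \<open>C\<close>.\<close>
  define c where "c = 1 + 2 * l / p"
  have c1: "1 \<le> c" using l p by (simp add: c_def)
  have "exp (l / p) \<le> 1 + l / p + (l / p)\<^sup>2" using l p by (intro exp_bound) auto
  also have "(l / p)\<^sup>2 \<le> l / p"
    unfolding power2_eq_square using l p by (intro mult_left_le_one_le) auto
  finally have "exp (l / p) ^ p \<le> c ^ p" by (intro power_mono) (auto simp: c_def)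
  then have cC: "real C \<le> c ^ p" using l(2) p(3) by (simp add: exp_of_nat_mult[symmetric])
  have cexp: "c ^ p \<le> exp (2 * l)"
    unfolding c_def using l p by (intro exp_ge_one_plus_x_over_n_power_n) auto
  define z where "z = (\<kappa> * c) ^ p"
  have z: "0 \<le> z" "z < \<delta> / 2"
  proof -
    show "0 \<le> z" using \<kappa>(1) c1 by (simp add: z_def)
    have "z \<le> \<kappa> ^ p * exp (2 * l)" using cexp \<kappa>(1)
      by (simp add: z_def power_mult_distrib mult_left_mono)
    then show "z < \<delta> / 2" using p(1) by simp
  qed
  \<comment> \<open>By Bernoulli's inequality this \<open>d\<close> satisfies
    \<open>1 + z \<le> d ^ p\<close>.\<close>
  define d where "d = 1 + z / p"
  have d1: "1 \<le> d" using z p by (simp add: d_def)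
  have "1 + real p * (z / p) \<le> (1 + z / p) ^ p"
    using z p(3) by (intro Bernoulli_inequality) (auto intro: order_trans[of _ 0])
  then have dp: "1 + (\<kappa> * c) ^ p \<le> d ^ p" using p(3) by (simp add: d_def z_def)
  define B where "B = d + \<theta> ^ n * (c - d)"
  have \<theta>n: "0 \<le> \<theta> ^ n" "\<theta> ^ n \<le> 1" using \<theta> by (auto simp: power_le_one)
  have "0 \<le> (1 - \<theta> ^ n) * (d - 1) + \<theta> ^ n * (c - 1)"
    using \<theta>n c1 d1 by (intro add_nonneg_nonneg mult_nonneg_nonneg) auto
  then have B1: "1 \<le> B" by (simp add: B_def algebra_simps)
  have "\<theta> ^ n * (c - d) \<le> \<theta> ^ n * (2 * l / p)"
    using \<theta>n(1) d1 by (intro mult_left_mono) (auto simp: c_def)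
  then have "B \<le> 1 + (z + 2 * (\<theta> ^ n * l)) / p"
    by (simp add: B_def d_def add_divide_distrib algebra_simps)
  also have "\<dots> \<le> 1 + \<delta> / p"
    using z(2) \<theta>l p(3) by (intro add_left_mono divide_right_mono) auto
  finally have "B ^ p \<le> (1 + \<delta> / p) ^ p" using B1 by (intro power_mono) auto
  also have "\<dots> \<le> exp \<delta>" using p(3) assms by (intro exp_ge_one_plus_x_over_n_power_n) auto
  finally have "B ^ p \<le> exp \<delta>" .
  moreover have "sep_bound f p s0 R (B * X)" if "0 \<le> R" "0 < X" "sep_bound f p s0 (\<sigma> * R) X" for R X
    unfolding B_def using that c1 d1
    by (intro sep_bound_growth[OF n(1) \<eta>(2,3) \<kappa>(1,3) C(1) cC _ _ dp]) auto
  ultimately show ?thesis using p(3) B1 by (intro exI[of _ p] exI[of _ B]) auto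
qed

text \<open>Enlarging the window by \<open>1 / \<sigma>\<close> advances \<open>t\<close> by
  \<open>l = ln (1 / \<sigma>)\<close> and multiplies the power sum by at most
  \<open>exp (\<epsilon> * l)\<close>. Iteration starts from the window \<open>{-1..1}\<close>, and
  the rounding of \<open>t / l\<close> costs one further factor
  \<open>exp (\<epsilon> * l)\<close>.\<close>

lemma power_sum_subexponential:
  assumes "0 < \<epsilon>"
  shows "\<exists>p X. 0 < X \<and> (\<forall>t\<ge>0. \<forall>E. finite E \<and> E \<subseteq> {- exp t..exp t} \<and> separated s0 E \<longrightarrow>
    (\<Sum>\<xi>\<in>E. f \<xi> ^ p) \<le> X * exp (\<epsilon> * t))"
proof -
  define l where "l = ln (1 / \<sigma>)"
  have l: "0 < l" using \<sigma>_pos \<sigma>_less by (simp add: l_def)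
  have \<delta>: "0 < \<epsilon> * l" using l assms by simp
  obtain p B where p: "0 < p" "0 < B" "B ^ p \<le> exp (\<epsilon> * l)"
    and B: "\<And>R X. 0 \<le> R \<Longrightarrow> 0 < X \<Longrightarrow> sep_bound f p s0 (\<sigma> * R) X \<Longrightarrow> sep_bound f p s0 R (B * X)"
    using sep_bound_growth_rate[OF \<delta>] by blast
  obtain N where N: "\<And>E. E \<subseteq> {-1..1} \<Longrightarrow> separated s0 E \<Longrightarrow> finite E \<and> card E \<le> N"
    using separated_card_bound[OF s0_pos, of 1] by blast
  \<comment> \<open>The summand 1 ensures \<open>1 \<le> Y\<close>, hence
    \<open>Y \<le> Y ^ p\<close>.\<close>
  define Y where "Y = real N + 1"
  have base: "sep_bound f p s0 1 Y"
    unfolding sep_bound_def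
  proof (intro allI impI)
    fix E assume E: "finite E \<and> E \<subseteq> {-1..1} \<and> separated s0 E"
    have "(\<Sum>\<xi>\<in>E. f \<xi> ^ p) \<le> (\<Sum>\<xi>\<in>E. 1)"
      using f by (intro sum_mono power_le_one) auto
    also have "\<dots> \<le> Y ^ 1" using N[of E] E by (simp add: Y_def)
    also have "\<dots> \<le> Y ^ p" using p(1) by (intro power_increasing) (auto simp: Y_def)
    finally show "(\<Sum>\<xi>\<in>E. f \<xi> ^ p) \<le> Y ^ p" .
  qed
  have iter: "sep_bound f p s0 (1 / \<sigma> ^ k) (B ^ k * Y)" for k
  proof (induction k)
    case 0
    then show ?case using base by simp
  next
    case (Suc k)
    then show ?case
      using B[of "1 / \<sigma> ^ Suc k" "B ^ k * Y"] \<sigma>_pos p(2) by (simp add: Y_def mult.assoc)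
  qed
  have "(\<Sum>\<xi>\<in>E. f \<xi> ^ p) \<le> Y ^ p * exp (\<epsilon> * l) * exp (\<epsilon> * t)"
    if t: "0 \<le> t" and E: "finite E" "E \<subseteq> {- exp t..exp t}" "separated s0 E" for t E
  proof -
    define k where "k = nat \<lceil>t / l\<rceil>"
    have "0 \<le> t / l" using t l by simp
    then have k: "t / l \<le> real k" "real k \<le> t / l + 1" unfolding k_def by linarith+
    have kl: "t \<le> k * l" "k * l \<le> t + l" using k l by (auto simp: field_simps)
    have "1 / \<sigma> ^ k = exp (k * l)"
      using \<sigma>_pos by (simp add: l_def exp_of_nat_mult power_one_over)
    then have "exp t \<le> 1 / \<sigma> ^ k" using kl(1) by simp
    then have "E \<subseteq> {-(1 / \<sigma> ^ k)..1 / \<sigma> ^ k}" using E(2) by force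
    then have "(\<Sum>\<xi>\<in>E. f \<xi> ^ p) \<le> (B ^ k * Y) ^ p"
      using E by (intro sep_boundD[OF iter])
    also have "\<dots> = Y ^ p * (B ^ p) ^ k" by (simp add: power_mult_distrib power_mult[symmetric] mult.commute)
    also have "\<dots> \<le> Y ^ p * exp (\<epsilon> * l) ^ k"
      using p by (intro mult_left_mono power_mono) (auto simp: Y_def)
    also have "exp (\<epsilon> * l) ^ k = exp (\<epsilon> * (k * l))"
      by (simp add: exp_of_nat_mult[symmetric] mult_ac)
    also have "\<dots> \<le> exp (\<epsilon> * (t + l))" using kl assms by simp
    finally show ?thesis by (simp add: Y_def exp_add algebra_simps)
  qed
  moreover have "0 < Y ^ p * exp (\<epsilon> * l)" by (simp add: Y_def)
  ultimately show ?thesis by blast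
qed

text \<open>A largest \<open>s0\<close>-separated subset \<open>E\<close> of the superlevel set
  covers it by intervals of radius \<open>s0\<close>, and each of its points contributes at least
  \<open>exp (- c * p * t)\<close> to the power sum. The constants \<open>p\<close> and
  \<open>D\<close> are chosen before \<open>c\<close>, so that \<open>c\<close> can later tend to
  0.\<close>

lemma superlevel_measure_subexponential:
  assumes [measurable]: "f \<in> borel_measurable borel" and "0 < \<epsilon>"
  shows "\<exists>p::nat. \<exists>D>0. \<forall>t\<ge>0. \<forall>c.
    measure lborel {\<xi> \<in> {- exp t..exp t}. f \<xi> \<ge> exp (- c * t)} \<le> D * exp ((\<epsilon> + c * p) * t)"
proof -
  from power_sum_subexponential[OF assms(2)] obtain p X where
    pX: "0 < X \<and> (\<forall>t\<ge>0. \<forall>E. finite E \<and> E \<subseteq> {- exp t..exp t} \<and> separated s0 E \<longrightarrow>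
      (\<Sum>\<xi>\<in>E. f \<xi> ^ p) \<le> X * exp (\<epsilon> * t))"
    by (elim exE) (rule that)
  have X: "0 < X" using pX by (rule conjunct1)
  have bd: "(\<Sum>\<xi>\<in>E. f \<xi> ^ p) \<le> X * exp (\<epsilon> * t)"
    if "0 \<le> t" "finite E" "E \<subseteq> {- exp t..exp t}" "separated s0 E" for t E
    using conjunct2[OF pX] that by simp
  have "measure lborel {\<xi> \<in> {- exp t..exp t}. f \<xi> \<ge> exp (- c * t)} \<le> 2 * s0 * X * exp ((\<epsilon> + c * p) * t)"
    if t: "0 \<le> t" for t c
  proof -
    define A where "A = {\<xi> \<in> {- exp t..exp t}. f \<xi> \<ge> exp (- c * t)}"
    have sub: "A \<subseteq> {- exp t..exp t}" by (auto simp: A_def)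
    let ?P = "\<lambda>E. E \<subseteq> A \<and> separated s0 E"
    obtain N where N: "\<And>E. E \<subseteq> {-exp t..exp t} \<Longrightarrow> separated s0 E \<Longrightarrow> finite E \<and> card E \<le> N"
      using separated_card_bound[OF s0_pos, of "exp t"] by blast
    have NA: "finite E \<and> card E \<le> N" if "?P E" for E
      using N[of E] that sub by (meson order_trans)
    have P0: "?P {}" by (simp add: separated_def)
    have PN: "\<forall>E. ?P E \<longrightarrow> card E < Suc N" using NA by (simp add: less_Suc_eq_le)
    have "\<exists>E. ?P E \<and> (\<forall>E'. ?P E' \<longrightarrow> card E' \<le> card E)"
      by (rule ex_has_greatest_nat[where P="?P" and k="{}" and f=card and b="Suc N", OF P0 PN])
    then obtain E where E': "?P E \<and> (\<forall>E'. ?P E' \<longrightarrow> card E' \<le> card E)" by (rule exE)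
    have E: "?P E" "\<And>E'. ?P E' \<Longrightarrow> card E' \<le> card E"
      using conjunct1[OF E'] conjunct2[OF E', rule_format] by auto
    have fin: "finite E" using NA E(1) by blast
    \<comment> \<open>An uncovered point could be added to \<open>E\<close>, contradicting its
      maximal cardinality.\<close>
    have cover: "A \<subseteq> (\<Union>e\<in>E. {e - s0..e + s0})"
    proof (rule ccontr)
      assume "\<not> A \<subseteq> (\<Union>e\<in>E. {e - s0..e + s0})"
      then obtain x where x: "x \<in> A" "\<And>e. e \<in> E \<Longrightarrow> s0 < \<bar>x - e\<bar>" by force
      then have "x \<notin> E" using s0_pos by fastforce
      have "?P (insert x E)"
        using E(1) x by (auto simp: separated_def abs_minus_commute intro: less_imp_le)
      then show False using E(2)[of "insert x E"] \<open>x \<notin> E\<close> fin by simp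
    qed
    have "measure lborel A \<le> measure lborel (\<Union>e\<in>E. {e - s0..e + s0})"
    proof (rule measure_mono_fmeasurable[OF cover])
      show "A \<in> sets lborel" unfolding A_def by simp
      show "(\<Union>e\<in>E. {e - s0..e + s0}) \<in> fmeasurable lborel"
        using fin by (intro fmeasurable.finite_UN) (auto simp: fmeasurable_def emeasure_lborel_Icc_eq)
    qed
    also have "\<dots> \<le> (\<Sum>e\<in>E. measure lborel {e - s0..e + s0})"
      using fin by (intro measure_UNION_le) auto
    also have "\<dots> = 2 * s0 * card E" using s0_pos by simp
    also have "card E \<le> X * exp ((\<epsilon> + c * p) * t)"
    proof -
      have "card E * exp (- c * t) ^ p = (\<Sum>\<xi>\<in>E. exp (- c * t) ^ p)" by simp
      also have "\<dots> \<le> (\<Sum>\<xi>\<in>E. f \<xi> ^ p)"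
        using E(1) by (intro sum_mono power_mono) (auto simp: A_def)
      also have "\<dots> \<le> X * exp (\<epsilon> * t)"
        using E(1) fin t sub by (intro bd) auto
      finally have "card E * exp (- c * t) ^ p * exp (c * p * t) \<le> X * exp (\<epsilon> * t) * exp (c * p * t)"
        by (rule mult_right_mono) simp
      moreover have "exp (- c * t) ^ p * exp (c * p * t) = 1"
        by (simp add: exp_of_nat_mult[symmetric] exp_add[symmetric] mult_ac)
      ultimately show ?thesis by (simp add: mult.assoc exp_add[symmetric] distrib_right)
    qed
    finally show ?thesis using s0_pos by (simp add: A_def mult.assoc)
  qed
  moreover have "0 < 2 * s0 * X" using s0_pos X by simp
  ultimately show ?thesis by blast
qed

end

section \<open>Fourier transforms of self-similar measures\<close>

text \<open>Rewriting self-similarity as a mixture (draw \<open>i\<close> with weight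
  \<open>p i\<close>, then push \<mu> forward by the i-th map) makes integration against a monadic
  bind applicable.\<close>

lemma self_similar_measure_eq_bind:
  assumes ss: "self_similar_measure m a b p \<mu>"
    and p: "\<And>i. i \<in> {1..m} \<Longrightarrow> 0 \<le> p i" "(\<Sum>i=1..m. p i) = 1"
  shows "\<mu> = Giry_Monad.bind (point_measure {1..m} p) (\<lambda>i. distr \<mu> borel (\<lambda>x. a i * x + b i))" (is "_ = Giry_Monad.bind ?P ?D")
    and "prob_space (point_measure {1..m} p)"
    and "(\<lambda>i. distr \<mu> borel (\<lambda>x. a i * x + b i)) \<in> point_measure {1..m} p \<rightarrow>\<^sub>M subprob_algebra borel"
proof -
  interpret \<mu>: prob_space \<mu> using ss by (simp add: self_similar_measure_def)
  have sets_\<mu> [simp, measurable_cong]: "sets \<mu> = sets borel"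
    using ss by (simp add: self_similar_measure_def)
  interpret P: prob_space ?P
  proof
    have "emeasure ?P (space ?P) = ennreal (\<Sum>i=1..m. p i)"
      by (subst emeasure_point_measure_finite) (auto simp: space_point_measure intro!: sum_ennreal p(1))
    then show "emeasure ?P (space ?P) = 1" using p(2) by simp
  qed
  show "prob_space ?P" by (rule P.prob_space_axioms)
  have prob_D: "prob_space (?D i)" for i by (intro \<mu>.prob_space_distr) simp
  show D: "?D \<in> ?P \<rightarrow>\<^sub>M subprob_algebra borel"
    using prob_D by (auto simp: space_subprob_algebra prob_space_imp_subprob_space)
  have ne: "space ?P \<noteq> {}" by (rule P.not_empty)
  interpret B: prob_space "Giry_Monad.bind ?P ?D"
    by (rule P.prob_space_bind[OF _ D]) (simp add: prob_D)
  show "\<mu> = Giry_Monad.bind ?P ?D"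
  proof (rule measure_eqI)
    show "sets \<mu> = sets (Giry_Monad.bind ?P ?D)" using ne by (simp add: sets_bind[of _ _ borel])
    fix A assume "A \<in> sets \<mu>"
    then have A: "A \<in> sets borel" by simp
    have "measure \<mu> A = (\<Sum>i=1..m. p i * measure (?D i) A)"
      using ss A by (simp add: self_similar_measure_def)
    also have "\<dots> = measure (Giry_Monad.bind ?P ?D) A"
      unfolding P.measure_bind[OF D A]
      by (subst lebesgue_integral_point_measure_finite) (use p(1) in auto)
    finally show "emeasure \<mu> A = emeasure (Giry_Monad.bind ?P ?D) A"
      by (simp only: \<mu>.emeasure_eq_measure B.emeasure_eq_measure)
  qed
qed

lemma self_similar_integral:
  fixes h :: "real \<Rightarrow> real"
  assumes ss: "self_similar_measure m a b p \<mu>"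
    and p: "\<And>i. i \<in> {1..m} \<Longrightarrow> 0 \<le> p i" "(\<Sum>i=1..m. p i) = 1"
    and h: "h \<in> borel_measurable borel" "\<And>x. \<bar>h x\<bar> \<le> B"
  shows "(\<integral>x. h x \<partial>\<mu>) = (\<Sum>i=1..m. p i * (\<integral>x. h (a i * x + b i) \<partial>\<mu>))"
proof -
  note bind = self_similar_measure_eq_bind[OF ss p]
  let ?P = "point_measure {1..m} p" and ?D = "\<lambda>i. distr \<mu> borel (\<lambda>x. a i * x + b i)"
  interpret P: prob_space ?P by (rule bind(2))
  interpret \<mu>: prob_space \<mu> using ss by (simp add: self_similar_measure_def)
  have [simp, measurable_cong]: "sets \<mu> = sets borel"
    using ss by (simp add: self_similar_measure_def)
  have prob_D: "prob_space (?D i)" for i by (intro \<mu>.prob_space_distr) simp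
  have "(\<integral>x. h x \<partial>\<mu>) = (\<integral>x. h x \<partial>(Giry_Monad.bind ?P ?D))" using bind(1) by simp
  also have "\<dots> = (\<integral>i. (\<integral>x. h x \<partial>?D i) \<partial>?P)"
  proof (rule integral_bind[OF h(1) _ bind(3) P.finite_measure_axioms])
    show "AE i in ?P. emeasure (?D i) (space (?D i)) \<le> ennreal 1"
      using prob_space.emeasure_space_1[OF prob_D] by (intro AE_I2) simp
  qed (rule h(2))
  also have "\<dots> = (\<Sum>i=1..m. p i * (\<integral>x. h x \<partial>?D i))"
    by (subst lebesgue_integral_point_measure_finite) (use p(1) in auto)
  also have "\<dots> = (\<Sum>i=1..m. p i * (\<integral>x. h (a i * x + b i) \<partial>\<mu>))"
    using h(1) by (simp add: integral_distr)
  finally show ?thesis .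
qed

lemma fourier_transform_eq_char: "fourier_transform \<mu> \<xi> = char \<mu> (- \<xi>)"
  by (simp add: fourier_transform_def char_def mult.assoc)

lemma self_similar_fourier_transform:
  assumes ss: "self_similar_measure m a b p \<mu>"
    and p: "\<And>i. i \<in> {1..m} \<Longrightarrow> 0 \<le> p i" "(\<Sum>i=1..m. p i) = 1"
  shows "fourier_transform \<mu> \<xi> = (\<Sum>i=1..m. p i * cis (- b i * \<xi>) * fourier_transform \<mu> (a i * \<xi>))"
proof -
  interpret \<mu>: prob_space \<mu> using ss by (simp add: self_similar_measure_def)
  have [simp, measurable_cong]: "sets \<mu> = sets borel"
    using ss by (simp add: self_similar_measure_def)
  define h where "h x = cis (- \<xi> * x)" for x :: real
  have F: "fourier_transform \<mu> \<zeta> = (\<integral>x. cis (- \<zeta> * x) \<partial>\<mu>)" for \<zeta>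
    by (simp add: fourier_transform_def cis_conv_exp mult.assoc)
  have [measurable]: "h \<in> borel_measurable borel" unfolding h_def
    by (intro borel_measurable_continuous_onI continuous_intros)
  have h1: "norm (h x) \<le> 1" "\<bar>Re (h x)\<bar> \<le> 1" "\<bar>Im (h x)\<bar> \<le> 1" for x by (auto simp: h_def)
  have int: "integrable \<mu> (\<lambda>x. h (s * x + r))" for s r
    by (rule \<mu>.integrable_const_bound[of _ 1]) (auto simp: h1)
  have "(\<integral>x. h x \<partial>\<mu>) = (\<Sum>i=1..m. p i * (\<integral>x. h (a i * x + b i) \<partial>\<mu>))"
  \<comment> \<open>The integral identity is stated for real functions, so real and imaginary parts
    are treated separately.\<close>
  proof (rule complex_eqI)
    have "Re (\<integral>x. h x \<partial>\<mu>) = (\<integral>x. Re (h x) \<partial>\<mu>)"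
      using int[of 1 0] by simp
    also have "\<dots> = (\<Sum>i=1..m. p i * (\<integral>x. Re (h (a i * x + b i)) \<partial>\<mu>))"
      by (rule self_similar_integral[OF ss p, of _ 1]) (auto simp: h1)
    finally show "Re (\<integral>x. h x \<partial>\<mu>) = Re (\<Sum>i=1..m. p i * (\<integral>x. h (a i * x + b i) \<partial>\<mu>))"
      using int by simp
    have "Im (\<integral>x. h x \<partial>\<mu>) = (\<integral>x. Im (h x) \<partial>\<mu>)"
      using int[of 1 0] by simp
    also have "\<dots> = (\<Sum>i=1..m. p i * (\<integral>x. Im (h (a i * x + b i)) \<partial>\<mu>))"
      by (rule self_similar_integral[OF ss p, of _ 1]) (auto simp: h1)
    finally show "Im (\<integral>x. h x \<partial>\<mu>) = Im (\<Sum>i=1..m. p i * (\<integral>x. h (a i * x + b i) \<partial>\<mu>))"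
      using int by simp
  qed
  moreover have "(\<integral>x. h (a i * x + b i) \<partial>\<mu>) = cis (- b i * \<xi>) * fourier_transform \<mu> (a i * \<xi>)" for i
  proof -
    have "h (a i * x + b i) = cis (- b i * \<xi>) * cis (- (a i * \<xi>) * x)" for x
      by (simp add: h_def cis_mult algebra_simps)
    then show ?thesis by (simp add: F)
  qed
  ultimately show ?thesis by (simp add: F h_def mult.assoc)
qed

section \<open>Interference of two phases\<close>

lemma cmod_cis_add: "cmod (cis x + cis y) = 2 * \<bar>cos ((x - y) / 2)\<bar>"
proof -
  have "cis x + cis y = cis ((x + y) / 2) * (cis ((x - y) / 2) + cis (- ((x - y) / 2)))"
    by (simp add: distrib_left cis_mult field_simps)
  also have "cis ((x - y) / 2) + cis (- ((x - y) / 2)) = of_real (2 * cos ((x - y) / 2))"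
    by (simp add: complex_eq_iff)
  finally show ?thesis by (simp only: norm_mult norm_cis norm_of_real abs_mult mult_1 abs_numeral)
qed

text \<open>This supplies \<open>near\<close> with \<open>L = pi / \<bar>\<beta>\<bar>\<close>.
  Subtracting the nearest multiple of \<open>pi\<close> leaves the modulus of the cosine unchanged
  and brings the argument into a range where cosine decreases in the absolute value.\<close>

lemma abs_cos_near_one:
  assumes "0 < \<eta>" "\<beta> \<noteq> 0"
  shows "\<exists>\<kappa>. 0 \<le> \<kappa> \<and> \<kappa> < 1 \<and> (\<forall>\<xi>. \<kappa> < \<bar>cos (\<beta> * \<xi>)\<bar> \<longrightarrow> (\<exists>N::int. \<bar>\<xi> - N * (pi / \<bar>\<beta>\<bar>)\<bar> \<le> \<eta>))"
proof -
  \<comment> \<open>The cap \<open>pi / 2\<close> keeps the threshold \<open>cos \<epsilon>\<close>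
    nonnegative.\<close>
  define \<epsilon> where "\<epsilon> = min (\<bar>\<beta>\<bar> * \<eta>) (pi / 2)"
  have \<epsilon>: "0 < \<epsilon>" "\<epsilon> \<le> pi / 2" "\<epsilon> \<le> \<bar>\<beta>\<bar> * \<eta>" using assms by (auto simp: \<epsilon>_def)
  have "\<exists>N::int. \<bar>\<xi> - N * (pi / \<bar>\<beta>\<bar>)\<bar> \<le> \<eta>" if \<xi>: "cos \<epsilon> < \<bar>cos (\<beta> * \<xi>)\<bar>" for \<xi>
  proof -
    define u where "u = \<bar>\<beta>\<bar> * \<xi>"
    define N where "N = round (u / pi)"
    define r where "r = u - N * pi"
    have "\<bar>of_int N - u / pi\<bar> \<le> 1 / 2" unfolding N_def by (rule of_int_round_abs_le)
    then have "\<bar>of_int N - u / pi\<bar> * pi \<le> 1 / 2 * pi" by (rule mult_right_mono) simp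
    moreover have "\<bar>of_int N - u / pi\<bar> * pi = \<bar>(of_int N - u / pi) * pi\<bar>" by (simp add: abs_mult)
    moreover have "(of_int N - u / pi) * pi = - r" by (simp add: r_def algebra_simps)
    ultimately have r: "\<bar>r\<bar> \<le> pi / 2" by simp
    have "cos (\<beta> * \<xi>) = cos u" by (cases "0 \<le> \<beta>") (simp_all add: u_def)
    also have "u = r + N * pi" by (simp add: r_def)
    also have "\<bar>cos (r + N * pi)\<bar> = \<bar>cos r\<bar>"
    proof -
      have "sin (of_int N * pi) = 0" by (simp add: sin_zero_iff_int2)
      moreover from this have "\<bar>cos (of_int N * pi)\<bar> = 1"
        using sin_cos_squared_add[of "of_int N * pi"] by (simp add: power2_eq_1_iff) auto
      ultimately show ?thesis by (simp add: cos_add abs_mult)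
    qed
    also have "\<bar>cos r\<bar> = cos \<bar>r\<bar>"
      using r cos_ge_zero[of r] by (simp add: abs_le_iff)
    finally have "cos \<epsilon> < cos \<bar>r\<bar>" using \<xi> by simp
    moreover have "cos \<bar>r\<bar> \<le> cos \<epsilon>" if "\<epsilon> \<le> \<bar>r\<bar>"
      using that r \<epsilon> pi_gt_zero by (intro cos_monotone_0_pi_le) linarith+
    ultimately have "\<bar>r\<bar> < \<epsilon>" by linarith
    moreover have "\<bar>r\<bar> = \<bar>\<beta>\<bar> * \<bar>\<xi> - N * (pi / \<bar>\<beta>\<bar>)\<bar>"
    proof -
      have "r = \<bar>\<beta>\<bar> * (\<xi> - N * (pi / \<bar>\<beta>\<bar>))" using assms(2) by (simp add: r_def u_def field_simps)
      then show ?thesis by (simp add: abs_mult)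
    qed
    ultimately have "\<bar>\<beta>\<bar> * \<bar>\<xi> - N * (pi / \<bar>\<beta>\<bar>)\<bar> \<le> \<bar>\<beta>\<bar> * \<eta>" using \<epsilon>(3) by linarith
    then show ?thesis using assms(2) by (auto simp: mult_le_cancel_left)
  qed
  moreover have "0 \<le> cos \<epsilon>" using \<epsilon> by (intro cos_ge_zero) auto
  moreover have "cos \<epsilon> < cos 0" using \<epsilon> by (intro cos_monotone_0_pi) auto
  ultimately show ?thesis by (intro exI[of _ "cos \<epsilon>"]) auto
qed

text \<open>Every map contracts towards \<open>x0\<close> by at least \<sigma>, so a point whose
  image is farther than \<open>r\<close> from \<open>x0\<close> is itself farther than
  \<open>r / \<sigma>\<close>. Hence the mass outside radius \<open>r\<close> is at most the mass
  outside \<open>r / \<sigma> ^ n\<close>, which tends to 0.\<close>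

lemma self_similar_support_singleton:
  assumes ss: "self_similar_measure m a b p \<mu>"
    and a: "\<And>i. i \<in> {1..m} \<Longrightarrow> \<bar>a i\<bar> < 1"
    and p: "\<And>i. i \<in> {1..m} \<Longrightarrow> 0 \<le> p i" "(\<Sum>i=1..m. p i) = 1"
    and fix_pt: "\<And>i. i \<in> {1..m} \<Longrightarrow> a i * x0 + b i = x0"
  shows "measure_support \<mu> = {x0}"
proof -
  interpret \<mu>: prob_space \<mu> using ss by (simp add: self_similar_measure_def)
  have sets_\<mu> [simp, measurable_cong]: "sets \<mu> = sets borel"
    using ss by (simp add: self_similar_measure_def)
  have space_\<mu> [simp]: "space \<mu> = UNIV" using sets_eq_imp_space_eq[OF sets_\<mu>] by simp
  \<comment> \<open>Inserting \<open>1/2\<close> makes \<sigma> positive, so that division by it is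
    safe.\<close>
  define \<sigma> where "\<sigma> = Max (insert (1/2) ((\<lambda>i. \<bar>a i\<bar>) ` {1..m}))"
  have \<sigma>: "0 < \<sigma>" "\<sigma> < 1" "\<And>i. i \<in> {1..m} \<Longrightarrow> \<bar>a i\<bar> \<le> \<sigma>"
  proof -
    have "1/2 \<le> \<sigma>" unfolding \<sigma>_def by (intro Max_ge) auto
    then show "0 < \<sigma>" by simp
    show "\<sigma> < 1" unfolding \<sigma>_def using a by (subst Max_less_iff) auto
    show "\<bar>a i\<bar> \<le> \<sigma>" if "i \<in> {1..m}" for i unfolding \<sigma>_def using that by (intro Max_ge) auto
  qed
  define T where "T r = {x. r < \<bar>x - x0\<bar>}" for r
  have T [measurable]: "T r \<in> sets borel" for r
    unfolding T_def by measurable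
  have step: "measure \<mu> (T r) \<le> measure \<mu> (T (r / \<sigma>))" if "0 < r" for r
  proof -
    have "measure \<mu> (T r) = (\<Sum>i=1..m. p i * measure (distr \<mu> borel (\<lambda>x. a i * x + b i)) (T r))"
      using ss by (simp add: self_similar_measure_def)
    also have "\<dots> \<le> (\<Sum>i=1..m. p i * measure \<mu> (T (r / \<sigma>)))"
    proof (intro sum_mono mult_left_mono)
      fix i assume i: "i \<in> {1..m}"
      have "(\<lambda>x. a i * x + b i) -` T r \<subseteq> T (r / \<sigma>)"
      proof
        fix x assume "x \<in> (\<lambda>x. a i * x + b i) -` T r"
        then have "r < \<bar>a i * x + b i - x0\<bar>" by (simp add: T_def)
        also have "a i * x + b i - x0 = a i * (x - x0)" using fix_pt[OF i] by (simp add: algebra_simps)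
        also have "\<bar>a i * (x - x0)\<bar> \<le> \<sigma> * \<bar>x - x0\<bar>"
          using \<sigma>(3)[OF i] by (simp add: abs_mult mult_right_mono)
        finally show "x \<in> T (r / \<sigma>)" using \<sigma>(1) by (simp add: T_def field_simps)
      qed
      then show "measure (distr \<mu> borel (\<lambda>x. a i * x + b i)) (T r) \<le> measure \<mu> (T (r / \<sigma>))"
        by (simp add: measure_distr) (intro \<mu>.finite_measure_mono, auto)
    qed (use p in auto)
    also have "\<dots> = measure \<mu> (T (r / \<sigma>))" by (simp only: sum_distrib_right[symmetric] p(2) mult_1)
    finally show ?thesis .
  qed
  have iter: "measure \<mu> (T r) \<le> measure \<mu> (T (r / \<sigma> ^ n))" if "0 < r" for r n
  proof (induction n)
    case (Suc n)
    have "measure \<mu> (T (r / \<sigma> ^ n)) \<le> measure \<mu> (T (r / \<sigma> ^ n / \<sigma>))"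
      using \<sigma>(1) that by (intro step) simp
    then show ?case using Suc by (simp add: mult.commute)
  qed simp
  have T0: "measure \<mu> (T r) = 0" if r: "0 < r" for r
  proof -
    have "(\<lambda>n. measure \<mu> (T (r / \<sigma> ^ n))) \<longlonglongrightarrow> measure \<mu> (\<Inter>n. T (r / \<sigma> ^ n))"
    proof (rule \<mu>.finite_Lim_measure_decseq)
      show "decseq (\<lambda>n. T (r / \<sigma> ^ n))"
      proof (rule decseq_SucI)
        fix n
        have "r / \<sigma> ^ n \<le> r / \<sigma> ^ Suc n"
          using \<sigma> r by (intro divide_left_mono power_decreasing mult_pos_pos) auto
        then show "T (r / \<sigma> ^ Suc n) \<subseteq> T (r / \<sigma> ^ n)" by (auto simp: T_def)
      qed
    qed auto
    moreover have "(\<Inter>n. T (r / \<sigma> ^ n)) = {}"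
    proof (rule ccontr)
      assume "(\<Inter>n. T (r / \<sigma> ^ n)) \<noteq> {}"
      then obtain x where x: "\<And>n. r / \<sigma> ^ n < \<bar>x - x0\<bar>" by (auto simp: T_def)
      have "(\<lambda>n. \<bar>x - x0\<bar> * \<sigma> ^ n) \<longlonglongrightarrow> \<bar>x - x0\<bar> * 0"
        using \<sigma> by (intro tendsto_intros LIMSEQ_power_zero) auto
      moreover have "r \<le> \<bar>x - x0\<bar> * \<sigma> ^ n" for n
        using x[of n] \<sigma>(1) by (simp add: field_simps)
      ultimately have "r \<le> \<bar>x - x0\<bar> * 0" by (intro LIMSEQ_le_const) auto
      then show False using r by simp
    qed
    ultimately have "(\<lambda>n. measure \<mu> (T (r / \<sigma> ^ n))) \<longlonglongrightarrow> 0" by simp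
    then have "measure \<mu> (T r) \<le> 0" using iter[OF r] by (intro LIMSEQ_le_const) auto
    then show ?thesis by (simp add: measure_le_0_iff)
  qed
  show ?thesis
  proof (intro equalityI subsetI)
    fix x assume x: "x \<in> measure_support \<mu>"
    show "x \<in> {x0}"
    proof (rule ccontr)
      assume "x \<notin> {x0}"
      then have d: "0 < \<bar>x - x0\<bar> / 2" by simp
      have "open (T (\<bar>x - x0\<bar> / 2))"
        unfolding T_def by (intro open_Collect_less continuous_intros)
      moreover have "x \<in> T (\<bar>x - x0\<bar> / 2)" using d by (simp add: T_def)
      ultimately have "0 < emeasure \<mu> (T (\<bar>x - x0\<bar> / 2))"
        using x by (auto simp: measure_support_def)
      then show False using T0[OF d] by (simp add: \<mu>.emeasure_eq_measure)
    qed
  next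
    fix x assume "x \<in> {x0}"
    have "0 < emeasure \<mu> U" if U: "open U" "x0 \<in> U" for U
    proof -
      obtain e where e: "0 < e" "ball x0 e \<subseteq> U" using U openE by blast
      have "UNIV \<subseteq> U \<union> T (e / 2)"
      proof
        fix y show "y \<in> U \<union> T (e / 2)"
          using e by (cases "\<bar>y - x0\<bar> \<le> e / 2") (auto simp: T_def dist_real_def abs_minus_commute subset_iff)
      qed
      then have "U \<union> T (e / 2) = space \<mu>" by auto
      then have "1 = measure \<mu> (U \<union> T (e / 2))" using \<mu>.prob_space by simp
      also have "\<dots> \<le> measure \<mu> U + measure \<mu> (T (e / 2))"
        using U by (intro measure_Un_le) auto
      finally have "1 \<le> measure \<mu> U" using T0[of "e / 2"] e by simp
      then show ?thesis by (simp add: \<mu>.emeasure_eq_measure)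
    qed
    then show "x \<in> measure_support \<mu>" using \<open>x \<in> {x0}\<close> by (simp add: measure_support_def)
  qed
qed

section \<open>Bounds for the growth rate\<close>

lemma superlevel_measure_lower_bound:
  assumes "real_distribution \<mu>" "0 < c"
  shows "\<exists>r>0. \<forall>\<^sub>F t in at_top.
    r \<le> measure lborel {\<xi> \<in> {- exp t..exp t}. cmod (fourier_transform \<mu> \<xi>) \<ge> exp (- c * t)}"
proof -
  interpret real_distribution \<mu> by fact
  have cont: "isCont (\<lambda>\<xi>. cmod (char \<mu> \<xi>)) 0"
    using isCont_char[of 0] by (intro continuous_intros)
  have [measurable]: "char \<mu> \<in> borel_measurable borel" by (rule char_measurable)
  have "\<forall>\<^sub>F \<xi> in nhds 0. 1 / 2 < cmod (char \<mu> \<xi>)"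
    using cont by (intro order_tendstoD(1)[where y="cmod (char \<mu> 0)"])
      (simp_all add: char_zero continuous_at tendsto_nhds_iff)
  then obtain d where d: "0 < d" "\<And>\<xi>. \<bar>\<xi>\<bar> < d \<Longrightarrow> 1 / 2 < cmod (char \<mu> \<xi>)"
    by (auto simp: eventually_nhds_metric dist_real_def)
  define r where "r = min (d / 2) 1"
  have r: "0 < r" "r < d" "r \<le> 1" using d by (auto simp: r_def)
  \<comment> \<open>Beyond \<open>ln 2 / c\<close> the threshold is at most \<open>1 / 2\<close>,
    and for nonnegative \<open>t\<close> the window contains \<open>{-1..1}\<close>; the fixed
    interval \<open>{-r..r}\<close> then lies in the superlevel set.\<close>
  have "\<forall>\<^sub>F t in at_top. max 0 (ln 2 / c) \<le> t" by (rule eventually_ge_at_top)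
  then have "\<forall>\<^sub>F t in at_top.
    2 * r \<le> measure lborel {\<xi> \<in> {- exp t..exp t}. cmod (fourier_transform \<mu> \<xi>) \<ge> exp (- c * t)}"
  proof eventually_elim
    case (elim t)
    let ?A = "{\<xi> \<in> {- exp t..exp t}. cmod (fourier_transform \<mu> \<xi>) \<ge> exp (- c * t)}"
    have "ln 2 \<le> c * t" using elim assms(2) by (simp add: field_simps)
    then have "exp (- (c * t)) \<le> exp (- ln 2)" by simp
    also have "\<dots> = 1 / 2" by (simp add: exp_minus)
    finally have half: "exp (- (c * t)) \<le> 1 / 2" .
    have t: "1 \<le> exp t" using elim by simp
    have "{-r..r} \<subseteq> ?A"
    proof
      fix \<xi> assume "\<xi> \<in> {-r..r}"
      then have \<xi>: "\<bar>- \<xi>\<bar> < d" "- r \<le> \<xi>" "\<xi> \<le> r" using r by auto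
      then have "- exp t \<le> \<xi>" "\<xi> \<le> exp t" using t r by linarith+
      then show "\<xi> \<in> ?A" using half d(2)[OF \<xi>(1)] by (simp add: fourier_transform_eq_char)
    qed
    then have "measure lborel {-r..r} \<le> measure lborel ?A"
    proof (rule measure_mono_fmeasurable)
      have m: "?A \<in> sets lborel" unfolding fourier_transform_eq_char by measurable
      have "{- exp t..exp t} \<in> fmeasurable lborel"
        by (simp add: fmeasurable_def emeasure_lborel_Icc_eq)
      then show "?A \<in> fmeasurable lborel" by (rule fmeasurableI2[OF _ _ m]) auto
    qed simp
    then show ?case using r by simp
  qed
  then show ?thesis using r by (intro exI[of _ "2 * r"]) auto
qed

lemma large_freq_rate_nonneg:
  assumes "real_distribution \<mu>" "0 < c"
  shows "0 \<le> large_freq_rate c \<mu>"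
proof -
  obtain r where r: "0 < r" and ev: "\<forall>\<^sub>F t in at_top.
    r \<le> measure lborel {\<xi> \<in> {- exp t..exp t}. cmod (fourier_transform \<mu> \<xi>) \<ge> exp (- c * t)}"
    using superlevel_measure_lower_bound[OF assms] by blast
  have "((\<lambda>t::real. 1 / t * ln r) \<longlongrightarrow> 0 * ln r) at_top"
    by (intro tendsto_intros tendsto_divide_0[OF tendsto_const]) (simp add: filterlim_ident filterlim_at_top_imp_at_infinity)
  then have "((\<lambda>t::real. ereal (1 / t * ln r)) \<longlongrightarrow> ereal 0) at_top"
    by (intro tendsto_ereal) simp
  then have "Limsup at_top (\<lambda>t::real. ereal (1 / t * ln r)) = 0"
    by (subst lim_imp_Limsup) (auto simp: zero_ereal_def)
  moreover have "Limsup at_top (\<lambda>t::real. ereal (1 / t * ln r)) \<le> large_freq_rate c \<mu>"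
    unfolding large_freq_rate_def
  proof (rule Limsup_mono, use ev eventually_gt_at_top[of 0] in eventually_elim)
    case (elim t)
    then show ?case using r
      by (simp only: ereal_less_eq) (intro mult_left_mono ln_mono, auto)
  qed
  ultimately show ?thesis by simp
qed

lemma large_freq_rate_le:
  assumes "real_distribution \<mu>" "0 < c" "0 < D"
    and bound: "\<And>t. 0 \<le> t \<Longrightarrow>
      measure lborel {\<xi> \<in> {- exp t..exp t}. cmod (fourier_transform \<mu> \<xi>) \<ge> exp (- c * t)} \<le> D * exp (s * t)"
  shows "large_freq_rate c \<mu> \<le> ereal s"
proof -
  obtain r where r: "0 < r" and ev: "\<forall>\<^sub>F t in at_top.
    r \<le> measure lborel {\<xi> \<in> {- exp t..exp t}. cmod (fourier_transform \<mu> \<xi>) \<ge> exp (- c * t)}"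
    using superlevel_measure_lower_bound[OF assms(1,2)] by blast
  have "((\<lambda>t::real. 1 / t * ln D + s) \<longlongrightarrow> 0 * ln D + s) at_top"
    by (intro tendsto_intros tendsto_divide_0[OF tendsto_const]) (simp add: filterlim_ident filterlim_at_top_imp_at_infinity)
  then have "((\<lambda>t::real. ereal (1 / t * ln D + s)) \<longlongrightarrow> ereal s) at_top"
    by (intro tendsto_ereal) simp
  then have "Limsup at_top (\<lambda>t::real. ereal (1 / t * ln D + s)) = ereal s"
    by (intro lim_imp_Limsup) auto
  moreover have "large_freq_rate c \<mu> \<le> Limsup at_top (\<lambda>t::real. ereal (1 / t * ln D + s))"
    unfolding large_freq_rate_def
  proof (rule Limsup_mono, use ev eventually_gt_at_top[of 0] in eventually_elim)
    case (elim t)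
    let ?M = "measure lborel {\<xi> \<in> {- exp t..exp t}. cmod (fourier_transform \<mu> \<xi>) \<ge> exp (- c * t)}"
    \<comment> \<open>The lower bound \<open>r\<close> enters only to make \<open>?M\<close>
      positive, as monotonicity of \<open>ln\<close> requires.\<close>
    have "ln ?M \<le> ln (D * exp (s * t))" using bound[of t] elim r by (intro ln_mono) auto
    also have "\<dots> = ln D + s * t" using assms(3) by (simp add: ln_mult)
    finally have "1 / t * ln ?M \<le> 1 / t * (ln D + s * t)" using elim by (intro mult_left_mono) auto
    also have "\<dots> = 1 / t * ln D + s" using elim by (simp add: distrib_left)
    finally show ?case by (simp only: ereal_less_eq)
  qed
  ultimately show ?thesis by simp
qed

text \<open>
  For non-commuting \<open>S i\<close> and \<open>S j\<close> the words \<open>(i, j)\<close> and \<open>(j, i)\<close> have equal weight and equal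
  contraction ratio but different translation parts, so their two terms interfere.
\<close>

lemma self_similar_damped_recursion:
  fixes a b p :: "nat \<Rightarrow> real"
  assumes a: "\<And>i. i \<in> {1..m} \<Longrightarrow> a i \<noteq> 0 \<and> \<bar>a i\<bar> < 1"
    and p: "\<And>i. i \<in> {1..m} \<Longrightarrow> 0 < p i" "(\<Sum>i=1..m. p i) = 1"
    and ss: "self_similar_measure m a b p \<mu>"
    and ij: "i \<in> {1..m}" "j \<in> {1..m}" "b i * (1 - a j) \<noteq> b j * (1 - a i)"
  shows "\<exists>w \<rho> \<sigma> L. damped_recursion (\<lambda>\<xi>. cmod (fourier_transform \<mu> \<xi>)) w ({1..m} \<times> {1..m}) {(i, j), (j, i)}
    (\<lambda>(k, l). p k * p l) (\<lambda>(k, l). a k * a l) \<rho> \<sigma> L"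
proof -
  \<comment> \<open>Half the difference between the translation parts of the compositions
    \<open>S i \<circ> S j\<close> and \<open>S j \<circ> S i\<close>; it is nonzero exactly when
    the two maps do not commute.\<close>
  define \<beta> where "\<beta> = (b i + a i * b j - (b j + a j * b i)) / 2"
  have \<beta>: "\<beta> \<noteq> 0" using ij(3) by (simp add: \<beta>_def algebra_simps)
  define F where "F = fourier_transform \<mu>"
  let ?K = "{1..m} \<times> {1..m}" and ?G = "{(i, j), (j, i)}"
  let ?q = "\<lambda>(k, l). p k * p l" and ?\<alpha> = "\<lambda>(k, l). a k * a l"
  define \<rho> where "\<rho> = Min ((\<lambda>k. \<bar>?\<alpha> k\<bar>) ` ?K)"
  define \<sigma> where "\<sigma> = Max ((\<lambda>k. \<bar>?\<alpha> k\<bar>) ` ?K)"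
  have K: "finite ?K" "?K \<noteq> {}" using ij by auto
  have \<alpha>: "0 < \<bar>?\<alpha> k\<bar>" "\<bar>?\<alpha> k\<bar> < 1" if k: "k \<in> ?K" for k
  proof -
    obtain k1 k2 where k12: "k = (k1, k2)" "k1 \<in> {1..m}" "k2 \<in> {1..m}" using k by auto
    then show "0 < \<bar>?\<alpha> k\<bar>" using a by simp
    have "\<bar>a k1\<bar> * \<bar>a k2\<bar> < 1 * 1" using a[OF k12(2)] a[OF k12(3)]
      by (intro mult_strict_mono) auto
    then show "\<bar>?\<alpha> k\<bar> < 1" using k12 by (simp add: abs_mult)
  qed
  have ne: "i \<noteq> j" using ij(3) by auto
  interpret \<mu>: real_distribution \<mu>
    using ss by (simp add: self_similar_measure_def real_distribution_def real_distribution_axioms_def)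
  have p0: "0 \<le> p k" if "k \<in> {1..m}" for k using p(1)[OF that] by simp
  have F1: "F \<xi> = (\<Sum>k=1..m. p k * cis (- b k * \<xi>) * F (a k * \<xi>))" for \<xi>
    unfolding F_def by (rule self_similar_fourier_transform[OF ss p0 p(2)])
  \<comment> \<open>The contribution of the word \<open>(k, l)\<close> to the twice iterated
    functional equation.\<close>
  define T where "T \<xi> k = (case k of (k, l) \<Rightarrow>
    (p k * p l) * cis (- (b k + a k * b l) * \<xi>) * F (a k * a l * \<xi>))" for \<xi> k
  have F2: "F \<xi> = (\<Sum>k\<in>?K. T \<xi> k)" for \<xi>
  proof -
    have "F \<xi> = (\<Sum>k=1..m. p k * cis (- b k * \<xi>) * (\<Sum>l=1..m. p l * cis (- b l * (a k * \<xi>)) * F (a l * (a k * \<xi>))))"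
      unfolding F1[of \<xi>] by (rule sum.cong[OF refl]) (simp only: F1[of "a _ * \<xi>"])
    also have "\<dots> = (\<Sum>k=1..m. \<Sum>l=1..m. T \<xi> (k, l))"
    proof (intro sum.cong refl)
      fix k
      have "p k * cis (- b k * \<xi>) * (p l * cis (- b l * (a k * \<xi>)) * F (a l * (a k * \<xi>))) = T \<xi> (k, l)" for l
      proof -
        have "cis (- (b k + a k * b l) * \<xi>) = cis (- b k * \<xi>) * cis (- b l * (a k * \<xi>))"
          by (simp add: cis_mult algebra_simps)
        moreover have "a k * a l * \<xi> = a l * (a k * \<xi>)" by simp
        ultimately show ?thesis by (simp add: T_def mult_ac)
      qed
      then show "p k * cis (- b k * \<xi>) * (\<Sum>l=1..m. p l * cis (- b l * (a k * \<xi>)) * F (a l * (a k * \<xi>))) = (\<Sum>l=1..m. T \<xi> (k, l))"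
        by (simp add: sum_distrib_left)
    qed
    finally show ?thesis by (simp add: sum.cartesian_product)
  qed
  have rec: "cmod (F \<xi>) \<le> (\<Sum>k\<in>?K. ?q k * ((if k \<in> ?G then \<bar>cos (\<beta> * \<xi>)\<bar> else 1) * cmod (F (?\<alpha> k * \<xi>))))"
    (is "_ \<le> (\<Sum>k\<in>?K. ?r k)") for \<xi>
  proof -
    have GK: "?G \<subseteq> ?K" using ij by auto
    have "(\<Sum>k\<in>?G. T \<xi> k) = (p i * p j) * F (a i * a j * \<xi>)
        * (cis (- (b i + a i * b j) * \<xi>) + cis (- (b j + a j * b i) * \<xi>))"
      using ne by (simp add: T_def mult_ac distrib_left)
    then have "cmod (\<Sum>k\<in>?G. T \<xi> k) = p i * p j * cmod (F (a i * a j * \<xi>))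
        * cmod (cis (- (b i + a i * b j) * \<xi>) + cis (- (b j + a j * b i) * \<xi>))"
      using p0[OF ij(1)] p0[OF ij(2)] by (simp add: norm_mult)
    also have "cmod (cis (- (b i + a i * b j) * \<xi>) + cis (- (b j + a j * b i) * \<xi>)) = 2 * \<bar>cos (\<beta> * \<xi>)\<bar>"
    proof -
      have "(- (b i + a i * b j) * \<xi> - - (b j + a j * b i) * \<xi>) / 2 = - (\<beta> * \<xi>)"
        by (simp add: \<beta>_def field_simps)
      then show ?thesis by (simp only: cmod_cis_add cos_minus)
    qed
    \<comment> \<open>As \<open>i \<noteq> j\<close>, the set \<open>?G\<close> has two elements
      with equal summands, which accounts for the factor 2.\<close>
    also have "p i * p j * cmod (F (a i * a j * \<xi>)) * (2 * \<bar>cos (\<beta> * \<xi>)\<bar>) = (\<Sum>k\<in>?G. ?r k)"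
      using ne by (simp add: mult_ac)
    finally have 1: "cmod (\<Sum>k\<in>?G. T \<xi> k) = (\<Sum>k\<in>?G. ?r k)" .
    have "cmod (\<Sum>k\<in>?K - ?G. T \<xi> k) \<le> (\<Sum>k\<in>?K - ?G. ?r k)"
    proof (rule order_trans[OF norm_sum], rule sum_mono)
      fix k assume k: "k \<in> ?K - ?G"
      then obtain k1 k2 where k12: "k = (k1, k2)" "k1 \<in> {1..m}" "k2 \<in> {1..m}" by auto
      show "cmod (T \<xi> k) \<le> ?r k"
        using k p0[OF k12(2)] p0[OF k12(3)] unfolding k12(1) by (auto simp: T_def norm_mult)
    qed
    then have "cmod (\<Sum>k\<in>?K - ?G. T \<xi> k) + cmod (\<Sum>k\<in>?G. T \<xi> k) \<le> (\<Sum>k\<in>?K - ?G. ?r k) + (\<Sum>k\<in>?G. ?r k)"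
      using 1 by simp
    also have "\<dots> = (\<Sum>k\<in>?K. ?r k)"
      by (rule sum.subset_diff[OF GK K(1), symmetric])
    finally have "cmod (\<Sum>k\<in>?K - ?G. T \<xi> k) + cmod (\<Sum>k\<in>?G. T \<xi> k) \<le> (\<Sum>k\<in>?K. ?r k)" .
    moreover have "F \<xi> = (\<Sum>k\<in>?K - ?G. T \<xi> k) + (\<Sum>k\<in>?G. T \<xi> k)"
      unfolding F2 by (rule sum.subset_diff[OF GK K(1)])
    ultimately show ?thesis
      using norm_triangle_ineq[of "\<Sum>k\<in>?K - ?G. T \<xi> k" "\<Sum>k\<in>?G. T \<xi> k"] by simp
  qed
  have "damped_recursion (\<lambda>\<xi>. cmod (F \<xi>)) (\<lambda>\<xi>. \<bar>cos (\<beta> * \<xi>)\<bar>) ?K ?G ?q ?\<alpha> \<rho> \<sigma> (pi / \<bar>\<beta>\<bar>)"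
  proof
    show "?G \<subseteq> ?K" using ij by auto
    show "0 < ?q k" if "k \<in> ?K" for k using that p(1) by auto
    have "(\<Sum>k\<in>?K. ?q k) = (\<Sum>k=1..m. p k) * (\<Sum>k=1..m. p k)"
      by (simp only: sum_product sum.cartesian_product)
    then show "(\<Sum>k\<in>?K. ?q k) = 1" by (simp only: p(2) mult_1)
    show "0 < \<rho>" unfolding \<rho>_def using K \<alpha> by (subst Min_gr_iff) auto
    show "\<sigma> < 1" unfolding \<sigma>_def using K \<alpha> by (subst Max_less_iff) auto
    show "\<rho> \<le> \<bar>?\<alpha> k\<bar> \<and> \<bar>?\<alpha> k\<bar> \<le> \<sigma>" if "k \<in> ?K" for k
      unfolding \<rho>_def \<sigma>_def using that K by (intro conjI Min_le Max_ge finite_imageI imageI)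
    show "0 \<le> cmod (F \<xi>) \<and> cmod (F \<xi>) \<le> 1" for \<xi>
      using \<mu>.cmod_char_le_1 by (simp add: F_def fourier_transform_eq_char)
    show "0 < pi / \<bar>\<beta>\<bar>" using \<beta> by simp
    show "\<exists>\<kappa>. 0 \<le> \<kappa> \<and> \<kappa> < 1 \<and> (\<forall>\<xi>. \<kappa> < \<bar>cos (\<beta> * \<xi>)\<bar> \<longrightarrow> (\<exists>N::int. \<bar>\<xi> - N * (pi / \<bar>\<beta>\<bar>)\<bar> \<le> \<eta>))"
      if "0 < \<eta>" for \<eta>
      by (rule abs_cos_near_one[OF that \<beta>])
  qed (use K rec in auto)
  then show ?thesis unfolding F_def by blast
qed

theorem theorem1:
  fixes m :: nat and a b p :: "nat \<Rightarrow> real" and \<mu> :: "real measure"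
  assumes "m > 1"
    and "\<And>i. i \<in> {1..m} \<Longrightarrow> a i \<noteq> 0 \<and> \<bar>a i\<bar> < 1"
    and "\<And>i. i \<in> {1..m} \<Longrightarrow> 0 < p i \<and> p i < 1"
    and "(\<Sum>i=1..m. p i) = 1"
    and "self_similar_measure m a b p \<mu>"
    and "\<not> (\<exists>x. measure_support \<mu> = {x})"
  shows "((\<lambda>c. large_freq_rate c \<mu>) \<longlongrightarrow> 0) (at_right 0)"
proof -
  interpret \<mu>: real_distribution \<mu>
    using assms(5) by (simp add: self_similar_measure_def real_distribution_def real_distribution_axioms_def)
  have rd: "real_distribution \<mu>" by (rule \<mu>.real_distribution_axioms)
  have p: "0 < p i" "0 \<le> p i" if "i \<in> {1..m}" for i using assms(3)[OF that] by auto
  \<comment> \<open>If all pairs commuted, the fixed point \<open>b 1 / (1 - a 1)\<close> of the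
    first map would be fixed by every map, and the support would be a single point.\<close>
  have "\<exists>i\<in>{1..m}. \<exists>j\<in>{1..m}. b i * (1 - a j) \<noteq> b j * (1 - a i)"
  proof (rule ccontr)
    assume "\<not> ?thesis"
    then have eq: "b i * (1 - a j) = b j * (1 - a i)" if "i \<in> {1..m}" "j \<in> {1..m}" for i j
      using that by blast
    have one: "1 \<in> {1..m}" using assms(1) by simp
    have "measure_support \<mu> = {b 1 / (1 - a 1)}"
    proof (rule self_similar_support_singleton[OF assms(5) _ p(2) assms(4)])
      fix i assume i: "i \<in> {1..m}"
      show "\<bar>a i\<bar> < 1" using assms(2)[OF i] by simp
      have "1 - a 1 \<noteq> 0" using assms(2)[OF one] by auto
      then show "a i * (b 1 / (1 - a 1)) + b i = b 1 / (1 - a 1)"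
        using eq[OF i one] by (simp add: field_simps)
    qed
    then show False using assms(6) by blast
  qed
  then obtain i j where ij: "i \<in> {1..m}" "j \<in> {1..m}" "b i * (1 - a j) \<noteq> b j * (1 - a i)" by blast
  obtain w \<rho> \<sigma> L where "damped_recursion (\<lambda>\<xi>. cmod (fourier_transform \<mu> \<xi>)) w ({1..m} \<times> {1..m}) {(i, j), (j, i)}
    (\<lambda>(k, l). p k * p l) (\<lambda>(k, l). a k * a l) \<rho> \<sigma> L"
    using self_similar_damped_recursion[OF assms(2) p(1) assms(4,5) ij] by blast
  then interpret R: damped_recursion "\<lambda>\<xi>. cmod (fourier_transform \<mu> \<xi>)" w "{1..m} \<times> {1..m}" "{(i, j), (j, i)}"
    "\<lambda>(k, l). p k * p l" "\<lambda>(k, l). a k * a l" \<rho> \<sigma> L .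
  have [measurable]: "char \<mu> \<in> borel_measurable borel" by (rule \<mu>.char_measurable)
  have meas: "(\<lambda>\<xi>. cmod (fourier_transform \<mu> \<xi>)) \<in> borel_measurable borel"
    unfolding fourier_transform_eq_char by measurable
  have nonneg: "\<forall>\<^sub>F c in at_right 0. 0 \<le> large_freq_rate c \<mu>"
    using eventually_at_right_less[of "0::real"] by eventually_elim (rule large_freq_rate_nonneg[OF rd])
  show ?thesis
  proof (rule order_tendstoI)
    fix y :: ereal assume y: "y < 0"
    show "\<forall>\<^sub>F c in at_right 0. y < large_freq_rate c \<mu>"
      using nonneg by eventually_elim (use y in \<open>rule less_le_trans\<close>)
  next
    fix y :: ereal assume "0 < y"
    then obtain e where e: "0 < ereal e" "ereal e < y" using ereal_dense2 by blast
    \<comment> \<open>Half of \<open>e\<close> serves as the growth exponent \<epsilon>; the other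
      half absorbs \<open>c * n\<close> for small \<open>c\<close>, since \<open>n\<close> does not
      depend on \<open>c\<close>.\<close>
    then have e2: "0 < e / 2" by simp
    from R.superlevel_measure_subexponential[OF meas e2] obtain n :: nat and D where D: "0 < D" and
      bd: "\<forall>t\<ge>0. \<forall>c. measure lborel {\<xi> \<in> {- exp t..exp t}. cmod (fourier_transform \<mu> \<xi>) \<ge> exp (- c * t)}
        \<le> D * exp ((e / 2 + c * n) * t)"
      by (elim exE conjE)
    have "((\<lambda>c::real. e / 2 + c * n) \<longlongrightarrow> e / 2 + 0 * real n) (at_right 0)" by (intro tendsto_intros)
    then have "\<forall>\<^sub>F c::real in at_right 0. e / 2 + c * n < e"
      by (rule order_tendstoD(2)) (use e2 in simp)
    then show "\<forall>\<^sub>F c in at_right 0. large_freq_rate c \<mu> < y"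
      using eventually_at_right_less[of "0::real"]
    proof eventually_elim
      case (elim c)
      have "large_freq_rate c \<mu> \<le> ereal (e / 2 + c * n)"
        using bd by (intro large_freq_rate_le[OF rd elim(2) D]) blast
      also have "\<dots> < ereal e" using elim(1) by simp
      finally show ?case using e(2) by (rule less_trans)
    qed
  qed
qed

end
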